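(* Let $G$ be a discrete group, $K$ a $G$-equivariant discrete monoid with unit, and $A^{*,*}=A^{*,*}(K\rtimes G,\mathbb T)$. Consider the filtration of $\mathrm{Tot}(A^{*,*})$ by the subcomplexes $\mathrm{Tot}(A^{*,*>q})$ and the spectral sequence $E_r^{p,q}$ it defines, converging to $H^*(\mathrm{Tot}(A^{*,*}))$. Let $\phi:H^3(\mathrm{Tot}(A^{*,*}))\to MS_G(K)$, $[\alpha\oplus\beta\oplus\theta]\mapsto[\alpha\oplus\beta]$. Then there are isomorphisms $$\ker\big(H^3(\mathrm{Tot}(A^{*,*}))\xrightarrow{\phi}MS_G(K)\big)\cong E_4^{0,3},\qquad\mathrm{coker}\big(H^3(\mathrm{Tot}(A^{*,*}))\xrightarrow{\phi}MS_G(K)\big)\cong d_3(E_3^{2,1})+d_2(E_2^{1,2}).$$ In the particular case in which the spectral sequence collapses at the second page, there is a short exact sequence $$0\to H^3(C^*(K,\mathbb T)^G)\to H^3(\mathrm{Tot}(A^{*,*}))\xrightarrow{\phi}MS_G(K)\to0.$$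
   Context: $\mathbb T=S^1$, written multiplicatively. $C^{p,q}(K\rtimes G,\mathbb T)$ is the group of maps $F:G^p\times K^q\to\mathbb T$, values $F[g_1|\dots|g_p||k_1|\dots|k_q]$, equal to $1$ if some $g_i$ or $k_j$ is the identity, with differentials $(\delta_GF)[g_1|\dots|g_{p+1}||k_1|\dots|k_q]=F[g_2|\dots|g_{p+1}||k_1|\dots|k_q]\prod_{i=1}^pF[\dots|g_ig_{i+1}|\dots||k_1|\dots|k_q]^{(-1)^i}F[g_1|\dots|g_p||g_{p+1}(k_1)|\dots|g_{p+1}(k_q)]^{(-1)^{p+1}}$ and $(\delta_KF)[g_1|\dots|g_p||k_1|\dots|k_{q+1}]=F[\dots||k_2|\dots|k_{q+1}]\prod_{j=1}^qF[\dots||\dots|k_jk_{j+1}|\dots]^{(-1)^j}F[\dots||k_1|\dots|k_q]^{(-1)^{q+1}}$. $A^{*,*}$ consists of the $C^{p,q}$ with $q>0$, and $A^{*,*>r}$ of those with $q>r$; total complexes carry the differential $\delta_G\oplus\delta_K^{(-1)^p}$. $MS_G(K)=\{[\alpha\oplus\beta]\in H^3(\mathrm{Tot}(A^{*,*}/A^{*,*>2})): [\delta_K\beta]=1\}$, $\alpha\in C^{2,1}$, $\beta\in C^{1,2}$, where $[\delta_K\beta]=1$ means $\delta_K\beta=\delta_G\theta$ for some $\theta\in C^{0,3}$. $C^*(K,\mathbb T)^G$ is the complex of $G$-invariant normalized cochains $K^q\to\mathbb T$ with differential $\delta_K$; it maps to $\mathrm{Tot}(A^{*,*})$ through $A^{0,*}$.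 In the spectral sequence, $p$ is the number of $G$-variables and $q\ge1$ the number of $K$-variables; $E_1^{p,q}$ is the $\delta_G$-cohomology of the row $A^{*,q}$ at $p$ (so $E_1^{0,q}=C^q(K,\mathbb T)^G$ and $E_1^{p,q}=H^p_G(K^q,\mathbb T)$), $d_1$ is induced by $\delta_K^{(-1)^p}$, $E_2^{0,q}=H^q(C^*(K,\mathbb T)^G)$, and $d_r:E_r^{p,q}\to E_r^{p-r+1,q+r}$. The notation $d_3(E_3^{2,1})+d_2(E_2^{1,2})$ (an abuse of notation in the paper) means the subgroup of $E_2^{0,4}$ containing $d_2(E_2^{1,2})$ whose image in $E_3^{0,4}=E_2^{0,4}/d_2(E_2^{1,2})$ is $d_3(E_3^{2,1})$; equivalently the kernel of $E_2^{0,4}\to H^4(\mathrm{Tot}(A^{*,*}))$. *)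

theory Defs
  imports Complex_Main "HOL-Algebra.Group_Action"
begin

text \<open>A monoid \<open>K\<close> with a left action of the group \<open>G\<close> by monoid automorphisms. Each \<open>act g\<close> is a
  bijective multiplicative map of \<open>carrier K\<close>, hence it also preserves the unit.\<close>

locale equivariant_monoid = group_action G "carrier K" act + K: monoid K
  for G :: "('g, 'm) monoid_scheme" and K :: "('k, 'n) monoid_scheme" and act +
  assumes act_hom: "g \<in> carrier G \<Longrightarrow> act g \<in> hom K K"


section \<open>The double complex of normalized cochains\<close>

definition tuples :: "('a, 'm) monoid_scheme \<Rightarrow> nat \<Rightarrow> 'a list set" where
  "tuples M n = {xs. set xs \<subseteq> carrier M \<and> length xs = n}"

text \<open>\<open>[x\<^sub>1,\<dots>,x\<^sub>n]\<close> becomes \<open>[x\<^sub>1,\<dots>,x\<^sub>i x\<^sub>i\<^sub>+\<^sub>1,\<dots>,x\<^sub>n]\<close>, where \<open>1 \<le> i < n\<close>.\<close>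

definition merge_at :: "('a, 'm) monoid_scheme \<Rightarrow> nat \<Rightarrow> 'a list \<Rightarrow> 'a list" where
  "merge_at M i xs = take (i - 1) xs @ [xs ! (i - 1) \<otimes>\<^bsub>M\<^esub> xs ! i] @ drop (i + 1) xs"

type_synonym ('g, 'k) cochain = "'g list \<Rightarrow> 'k list \<Rightarrow> complex"

text \<open>\<open>C\<^sup>p\<^sup>,\<^sup>q(K \<rtimes> G, \<T>)\<close>: \<open>F gs ks\<close> stands for \<open>F[g\<^sub>1|\<dots>|g\<^sub>p||k\<^sub>1|\<dots>|k\<^sub>q]\<close>, and \<open>\<T>\<close> is the unit circle
  in the complex plane. So that cochains with the same values are equal, they are extended by \<open>1\<close>
  outside \<open>G\<^sup>p \<times> K\<^sup>q\<close>; the group law is pointwise multiplication.\<close>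

definition cochains ::
  "('g, 'm) monoid_scheme \<Rightarrow> ('k, 'n) monoid_scheme \<Rightarrow> nat \<Rightarrow> nat \<Rightarrow> ('g, 'k) cochain monoid" where
  "cochains G K p q =
     \<lparr>carrier = {F. \<forall>gs ks.
        (gs \<in> tuples G p \<and> ks \<in> tuples K q \<longrightarrow>
           cmod (F gs ks) = 1 \<and> (\<one>\<^bsub>G\<^esub> \<in> set gs \<or> \<one>\<^bsub>K\<^esub> \<in> set ks \<longrightarrow> F gs ks = 1)) \<and>
        (\<not> (gs \<in> tuples G p \<and> ks \<in> tuples K q) \<longrightarrow> F gs ks = 1)},
      monoid.mult = (\<lambda>F F' gs ks. F gs ks * F' gs ks),
      one = (\<lambda>gs ks. 1)\<rparr>"

text \<open>\<open>\<delta>\<^sub>G : C\<^sup>p\<^sup>,\<^sup>q \<rightarrow> C\<^sup>p\<^sup>+\<^sup>1\<^sup>,\<^sup>q\<close> and \<open>\<delta>\<^sub>K : C\<^sup>p\<^sup>,\<^sup>q \<rightarrow> C\<^sup>p\<^sup>,\<^sup>q\<^sup>+\<^sup>1\<close>; the indices are those of the source.\<close>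

definition delta_G ::
  "('g, 'm) monoid_scheme \<Rightarrow> ('k, 'n) monoid_scheme \<Rightarrow> ('g \<Rightarrow> 'k \<Rightarrow> 'k) \<Rightarrow> nat \<Rightarrow> nat
     \<Rightarrow> ('g, 'k) cochain \<Rightarrow> ('g, 'k) cochain" where
  "delta_G G K act p q F = (\<lambda>gs ks.
     if gs \<in> tuples G (p + 1) \<and> ks \<in> tuples K q
     then F (tl gs) ks
        * (\<Prod>i = 1..p. F (merge_at G i gs) ks powi ((-1) ^ i))
        * F (butlast gs) (map (act (last gs)) ks) powi ((-1) ^ (p + 1))
     else 1)"

definition delta_K ::
  "('g, 'm) monoid_scheme \<Rightarrow> ('k, 'n) monoid_scheme \<Rightarrow> nat \<Rightarrow> nat
     \<Rightarrow> ('g, 'k) cochain \<Rightarrow> ('g, 'k) cochain" where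
  "delta_K G K p q F = (\<lambda>gs ks.
     if gs \<in> tuples G p \<and> ks \<in> tuples K (q + 1)
     then F gs (tl ks)
        * (\<Prod>j = 1..q. F gs (merge_at K j ks) powi ((-1) ^ j))
        * F gs (butlast ks) powi ((-1) ^ (q + 1))
     else 1)"


section \<open>Total complexes\<close>

text \<open>An element \<open>x\<close> of \<open>tot G K Q n\<close> has components \<open>x q \<in> C\<^sup>n\<^sup>-\<^sup>q\<^sup>,\<^sup>q\<close> for \<open>q \<in> Q\<close>, \<open>q \<le> n\<close>; all other
  components are trivial. Thus \<open>Q = {1..}\<close> gives \<open>Tot(A)\<close>, \<open>Q = {r+1..}\<close> the subcomplex
  \<open>Tot(A\<^sup>*\<^sup>,\<^sup>*\<^sup>>\<^sup>r)\<close> (a subset of the former), and \<open>Q = {1..r}\<close> the quotient \<open>Tot(A\<^sup>*\<^sup>,\<^sup>*/A\<^sup>*\<^sup>,\<^sup>*\<^sup>>\<^sup>r)\<close>, for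
  which \<open>tot_d\<close> discards the components of the differential of \<open>K\<close>-degree \<open>> r\<close>.\<close>

definition tot ::
  "('g, 'm) monoid_scheme \<Rightarrow> ('k, 'n) monoid_scheme \<Rightarrow> nat set \<Rightarrow> nat
     \<Rightarrow> (nat \<Rightarrow> ('g, 'k) cochain) monoid" where
  "tot G K Q n =
     \<lparr>carrier = {x. \<forall>q. (q \<in> Q \<and> q \<le> n \<longrightarrow> x q \<in> carrier (cochains G K (n - q) q)) \<and>
                        (\<not> (q \<in> Q \<and> q \<le> n) \<longrightarrow> x q = (\<lambda>gs ks. 1))},
      monoid.mult = (\<lambda>x y q gs ks. x q gs ks * y q gs ks),
      one = (\<lambda>q gs ks. 1)\<rparr>"

text \<open>The component in \<open>C\<^sup>p\<^sup>,\<^sup>q\<close>, \<open>p + q = n + 1\<close>, of the differential of \<open>x\<close> of total degree \<open>n\<close> is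
  \<open>\<delta>\<^sub>G (x q)\<close> times \<open>\<delta>\<^sub>K (x (q - 1))\<close> to the power \<open>(-1)\<^sup>p\<close>. Truncated subtractions below only concern
  trivial components of \<open>x\<close>, provided \<open>0 \<notin> Q\<close>.\<close>

definition tot_d ::
  "('g, 'm) monoid_scheme \<Rightarrow> ('k, 'n) monoid_scheme \<Rightarrow> ('g \<Rightarrow> 'k \<Rightarrow> 'k) \<Rightarrow> nat set \<Rightarrow> nat
     \<Rightarrow> (nat \<Rightarrow> ('g, 'k) cochain) \<Rightarrow> (nat \<Rightarrow> ('g, 'k) cochain)" where
  "tot_d G K act Q n x = (\<lambda>q gs ks.
     if q \<in> Q
     then delta_G G K act (n - q) q (x q) gs ks
        * delta_K G K (n + 1 - q) (q - 1) (x (q - 1)) gs ks powi ((-1) ^ (n + 1 - q))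
     else 1)"

definition tot_cocycles ::
  "('g, 'm) monoid_scheme \<Rightarrow> ('k, 'n) monoid_scheme \<Rightarrow> ('g \<Rightarrow> 'k \<Rightarrow> 'k) \<Rightarrow> nat set \<Rightarrow> nat
     \<Rightarrow> (nat \<Rightarrow> ('g, 'k) cochain) set" where
  "tot_cocycles G K act Q n = kernel (tot G K Q n) (tot G K Q (n + 1)) (tot_d G K act Q n)"

text \<open>Since \<open>0 \<notin> Q\<close> in all cases of interest, there is nothing of total degree \<open>0\<close>, and it is
  harmless that for \<open>n = 0\<close> the truncated \<open>n - 1\<close> is again \<open>0\<close>.\<close>

definition tot_coboundaries ::
  "('g, 'm) monoid_scheme \<Rightarrow> ('k, 'n) monoid_scheme \<Rightarrow> ('g \<Rightarrow> 'k \<Rightarrow> 'k) \<Rightarrow> nat set \<Rightarrow> nat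
     \<Rightarrow> (nat \<Rightarrow> ('g, 'k) cochain) set" where
  "tot_coboundaries G K act Q n = tot_d G K act Q (n - 1) ` carrier (tot G K Q (n - 1))"

definition tot_H ::
  "('g, 'm) monoid_scheme \<Rightarrow> ('k, 'n) monoid_scheme \<Rightarrow> ('g \<Rightarrow> 'k \<Rightarrow> 'k) \<Rightarrow> nat set \<Rightarrow> nat
     \<Rightarrow> (nat \<Rightarrow> ('g, 'k) cochain) set monoid" where
  "tot_H G K act Q n =
     (tot G K Q n)\<lparr>carrier := tot_cocycles G K act Q n\<rparr> Mod tot_coboundaries G K act Q n"


section \<open>The group \<open>MS\<^sub>G(K)\<close> and the map \<open>\<phi>\<close>\<close>

text \<open>A representative \<open>x = \<alpha> \<oplus> \<beta>\<close> has \<open>\<alpha> = x 1\<close> and \<open>\<beta> = x 2\<close>.\<close>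

definition MS ::
  "('g, 'm) monoid_scheme \<Rightarrow> ('k, 'n) monoid_scheme \<Rightarrow> ('g \<Rightarrow> 'k \<Rightarrow> 'k)
     \<Rightarrow> (nat \<Rightarrow> ('g, 'k) cochain) set monoid" where
  "MS G K act = (tot_H G K act {1..2} 3)
     \<lparr>carrier := {X \<in> carrier (tot_H G K act {1..2} 3).
        \<exists>x\<in>X. \<exists>\<theta>\<in>carrier (cochains G K 0 3). delta_K G K 1 2 (x 2) = delta_G G K act 0 3 \<theta>}\<rparr>"

text \<open>For a map \<open>f\<close> of representatives into \<open>M\<close>, sending a coset \<open>X\<close> to the coset of \<open>B\<close> generated by
  the image of \<open>X\<close>: if \<open>f\<close> is well defined modulo \<open>B\<close>, this is the coset of \<open>f x\<close> for any \<open>x \<in> X\<close>.\<close>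

definition induced :: "('b, 'm) monoid_scheme \<Rightarrow> 'b set \<Rightarrow> ('a \<Rightarrow> 'b) \<Rightarrow> 'a set \<Rightarrow> 'b set" where
  "induced M B f X = B <#>\<^bsub>M\<^esub> (f ` X)"

definition phi ::
  "('g, 'm) monoid_scheme \<Rightarrow> ('k, 'n) monoid_scheme \<Rightarrow> ('g \<Rightarrow> 'k \<Rightarrow> 'k)
     \<Rightarrow> (nat \<Rightarrow> ('g, 'k) cochain) set \<Rightarrow> (nat \<Rightarrow> ('g, 'k) cochain) set" where
  "phi G K act = induced (tot G K {1..2} 3) (tot_coboundaries G K act {1..2} 3)
     (\<lambda>x q. if q \<le> 2 then x q else (\<lambda>gs ks. 1))"


section \<open>Invariant cochains on \<open>K\<close>\<close>

text \<open>\<open>C\<^sup>q(K,\<T>)\<^sup>G\<close>, with maps on \<open>K\<^sup>q\<close> regarded as maps on \<open>G\<^sup>0 \<times> K\<^sup>q\<close>.\<close>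

definition inv_cochains ::
  "('g, 'm) monoid_scheme \<Rightarrow> ('k, 'n) monoid_scheme \<Rightarrow> ('g \<Rightarrow> 'k \<Rightarrow> 'k) \<Rightarrow> nat
     \<Rightarrow> ('g, 'k) cochain monoid" where
  "inv_cochains G K act q = (cochains G K 0 q)
     \<lparr>carrier := {F \<in> carrier (cochains G K 0 q).
        \<forall>g\<in>carrier G. \<forall>ks\<in>tuples K q. F [] (map (act g) ks) = F [] ks}\<rparr>"

text \<open>\<open>H\<^sup>q(C\<^sup>*(K,\<T>)\<^sup>G)\<close> for \<open>q \<ge> 1\<close>.\<close>

definition inv_H ::
  "('g, 'm) monoid_scheme \<Rightarrow> ('k, 'n) monoid_scheme \<Rightarrow> ('g \<Rightarrow> 'k \<Rightarrow> 'k) \<Rightarrow> nat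
     \<Rightarrow> ('g, 'k) cochain set monoid" where
  "inv_H G K act q =
     (inv_cochains G K act q)
       \<lparr>carrier := kernel (inv_cochains G K act q) (inv_cochains G K act (q + 1)) (delta_K G K 0 q)\<rparr>
     Mod (delta_K G K 0 (q - 1) ` carrier (inv_cochains G K act (q - 1)))"

text \<open>The map on cohomology induced by \<open>C\<^sup>q(K,\<T>)\<^sup>G \<subseteq> A\<^sup>0\<^sup>,\<^sup>q \<rightarrow> Tot(A)\<close>.\<close>

definition inv_H_to_tot_H ::
  "('g, 'm) monoid_scheme \<Rightarrow> ('k, 'n) monoid_scheme \<Rightarrow> ('g \<Rightarrow> 'k \<Rightarrow> 'k) \<Rightarrow> nat
     \<Rightarrow> ('g, 'k) cochain set \<Rightarrow> (nat \<Rightarrow> ('g, 'k) cochain) set" where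
  "inv_H_to_tot_H G K act q = induced (tot G K {1..} q) (tot_coboundaries G K act {1..} q)
     (\<lambda>F j. if j = q then F else (\<lambda>gs ks. 1))"


section \<open>The spectral sequence of the filtration\<close>

text \<open>The standard spectral sequence of the decreasing filtration
  \<open>F\<^sup>s = Tot(A\<^sup>*\<^sup>,\<^sup>*\<^sup>\<ge>\<^sup>s) = Tot(A\<^sup>*\<^sup>,\<^sup>*\<^sup>>\<^sup>s\<^sup>-\<^sup>1)\<close>, for \<open>r \<ge> 1\<close>:

  \<open>E\<^sub>r\<^sup>p\<^sup>,\<^sup>q = {x \<in> F\<^sup>q Tot\<^sup>p\<^sup>+\<^sup>q. d x \<in> F\<^sup>q\<^sup>+\<^sup>r}\<close> modulo
  \<open>{x \<in> F\<^sup>q\<^sup>+\<^sup>1 Tot\<^sup>p\<^sup>+\<^sup>q. d x \<in> F\<^sup>q\<^sup>+\<^sup>r} + d {y \<in> F\<^sup>q\<^sup>-\<^sup>r\<^sup>+\<^sup>1 Tot\<^sup>p\<^sup>+\<^sup>q\<^sup>-\<^sup>1. d y \<in> F\<^sup>q}\<close>.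

  Truncated subtraction in the filtration index \<open>q - r + 1\<close> is harmless, since \<open>F\<^sup>s\<close> is the whole
  complex for all \<open>s \<le> 1\<close>.\<close>

definition fil ::
  "('g, 'm) monoid_scheme \<Rightarrow> ('k, 'n) monoid_scheme \<Rightarrow> nat \<Rightarrow> nat
     \<Rightarrow> (nat \<Rightarrow> ('g, 'k) cochain) set" where
  "fil G K s n = carrier (tot G K ({1..} \<inter> {s..}) n)"

definition fil_Z ::
  "('g, 'm) monoid_scheme \<Rightarrow> ('k, 'n) monoid_scheme \<Rightarrow> ('g \<Rightarrow> 'k \<Rightarrow> 'k) \<Rightarrow> nat \<Rightarrow> nat \<Rightarrow> nat
     \<Rightarrow> (nat \<Rightarrow> ('g, 'k) cochain) set" where
  "fil_Z G K act s t n = {x \<in> fil G K s n. tot_d G K act {1..} n x \<in> fil G K t (n + 1)}"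

text \<open>The denominator of \<open>E\<^sub>r\<^sup>p\<^sup>,\<^sup>q\<close>, where \<open>n = p + q\<close>. It is indexed by \<open>n\<close> rather than \<open>p\<close> because the
  target \<open>E\<^sub>r\<^sup>p\<^sup>-\<^sup>r\<^sup>+\<^sup>1\<^sup>,\<^sup>q\<^sup>+\<^sup>r\<close> of \<open>d\<^sub>r\<close> may have negative first index (and is then trivial).\<close>

definition ss_B ::
  "('g, 'm) monoid_scheme \<Rightarrow> ('k, 'n) monoid_scheme \<Rightarrow> ('g \<Rightarrow> 'k \<Rightarrow> 'k) \<Rightarrow> nat \<Rightarrow> nat \<Rightarrow> nat
     \<Rightarrow> (nat \<Rightarrow> ('g, 'k) cochain) set" where
  "ss_B G K act r n q = fil_Z G K act (q + 1) (q + r) n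
     <#>\<^bsub>tot G K {1..} n\<^esub> (tot_d G K act {1..} (n - 1) ` fil_Z G K act (q + 1 - r) q (n - 1))"

definition ss_E ::
  "('g, 'm) monoid_scheme \<Rightarrow> ('k, 'n) monoid_scheme \<Rightarrow> ('g \<Rightarrow> 'k \<Rightarrow> 'k) \<Rightarrow> nat \<Rightarrow> nat \<Rightarrow> nat
     \<Rightarrow> (nat \<Rightarrow> ('g, 'k) cochain) set monoid" where
  "ss_E G K act r p q =
     (tot G K {1..} (p + q))\<lparr>carrier := fil_Z G K act q (q + r) (p + q)\<rparr> Mod ss_B G K act r (p + q) q"

definition ss_d ::
  "('g, 'm) monoid_scheme \<Rightarrow> ('k, 'n) monoid_scheme \<Rightarrow> ('g \<Rightarrow> 'k \<Rightarrow> 'k) \<Rightarrow> nat \<Rightarrow> nat \<Rightarrow> nat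
     \<Rightarrow> (nat \<Rightarrow> ('g, 'k) cochain) set \<Rightarrow> (nat \<Rightarrow> ('g, 'k) cochain) set" where
  "ss_d G K act r p q = induced (tot G K {1..} (p + q + 1))
     (ss_B G K act r (p + q + 1) (q + r)) (tot_d G K act {1..} (p + q))"

text \<open>All differentials from the second page on vanish; the unit of the target of \<open>d\<^sub>r\<close> is the
  trivial coset \<open>ss_B\<close>.\<close>

definition collapses_at_second_page ::
  "('g, 'm) monoid_scheme \<Rightarrow> ('k, 'n) monoid_scheme \<Rightarrow> ('g \<Rightarrow> 'k \<Rightarrow> 'k) \<Rightarrow> bool" where
  "collapses_at_second_page G K act \<longleftrightarrow>
     (\<forall>r\<ge>2. \<forall>p q. \<forall>X\<in>carrier (ss_E G K act r p q).
        ss_d G K act r p q X = ss_B G K act r (p + q + 1) (q + r))"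

text \<open>The canonical projection \<open>E\<^sub>2\<^sup>0\<^sup>,\<^sup>4 \<rightarrow> E\<^sub>3\<^sup>0\<^sup>,\<^sup>4 = E\<^sub>2\<^sup>0\<^sup>,\<^sup>4 / d\<^sub>2(E\<^sub>2\<^sup>1\<^sup>,\<^sup>2)\<close>.\<close>

definition E2_to_E3 ::
  "('g, 'm) monoid_scheme \<Rightarrow> ('k, 'n) monoid_scheme \<Rightarrow> ('g \<Rightarrow> 'k \<Rightarrow> 'k)
     \<Rightarrow> (nat \<Rightarrow> ('g, 'k) cochain) set \<Rightarrow> (nat \<Rightarrow> ('g, 'k) cochain) set" where
  "E2_to_E3 G K act = induced (tot G K {1..} 4) (ss_B G K act 3 4 4) (\<lambda>x. x)"

text \<open>\<open>d\<^sub>3(E\<^sub>3\<^sup>2\<^sup>,\<^sup>1) + d\<^sub>2(E\<^sub>2\<^sup>1\<^sup>,\<^sup>2)\<close>: the subgroup of \<open>E\<^sub>2\<^sup>0\<^sup>,\<^sup>4\<close> that contains \<open>d\<^sub>2(E\<^sub>2\<^sup>1\<^sup>,\<^sup>2)\<close>, the kernel of the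
  projection to \<open>E\<^sub>3\<^sup>0\<^sup>,\<^sup>4\<close>, and has image \<open>d\<^sub>3(E\<^sub>3\<^sup>2\<^sup>,\<^sup>1)\<close> there, i.e. the preimage of the latter.\<close>

definition d3_plus_d2 ::
  "('g, 'm) monoid_scheme \<Rightarrow> ('k, 'n) monoid_scheme \<Rightarrow> ('g \<Rightarrow> 'k \<Rightarrow> 'k)
     \<Rightarrow> (nat \<Rightarrow> ('g, 'k) cochain) set monoid" where
  "d3_plus_d2 G K act = (ss_E G K act 2 0 4)
     \<lparr>carrier := {X \<in> carrier (ss_E G K act 2 0 4).
        E2_to_E3 G K act X \<in> ss_d G K act 3 2 1 ` carrier (ss_E G K act 3 2 1)}\<rparr>"


section \<open>Short exact sequences\<close>

text \<open>\<open>0 \<rightarrow> A \<rightarrow> B \<rightarrow> C \<rightarrow> 0\<close>; the library predicate \<open>short_exact_sequence\<close> forces all groups to have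
  elements of the same type.\<close>

definition short_exact ::
  "('a, 'l) monoid_scheme \<Rightarrow> ('b, 'm) monoid_scheme \<Rightarrow> ('c, 'n) monoid_scheme
     \<Rightarrow> ('a \<Rightarrow> 'b) \<Rightarrow> ('b \<Rightarrow> 'c) \<Rightarrow> bool" where
  "short_exact A B C f g \<longleftrightarrow>
     group A \<and> group B \<and> group C \<and> f \<in> mon A B \<and> g \<in> epi B C \<and> f ` carrier A = kernel B C g"

end

theory Submission
  imports Defs
begin

text \<open>Let \<open>d\<close> be the differential of \<open>Tot(A)\<close> in degree 3, \<open>Z\<close> and \<open>B\<close> its cocycles and coboundaries,
  \<open>\<tau>\<close> the truncation \<open>\<alpha> \<oplus> \<beta> \<oplus> \<theta> \<mapsto> \<alpha> \<oplus> \<beta>\<close> with kernel \<open>F = A\<^sup>0\<^sup>,\<^sup>3\<close>, and \<open>W\<close> the group of those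
  \<open>x\<close> of degree 3 with \<open>d x \<in> A\<^sup>0\<^sup>,\<^sup>4\<close>. The condition \<open>[\<delta>\<^sub>K \<beta>] = 1\<close> says that \<open>\<alpha> \<oplus> \<beta>\<close> lifts to \<open>W\<close>, so \<open>\<phi>\<close> is
  the map \<open>Z/B \<rightarrow> \<tau>W/\<tau>B\<close> induced by \<open>\<tau>\<close>. Its kernel is \<open>(Z \<inter> F)/(B \<inter> F) = E\<^sub>4\<^sup>0\<^sup>,\<^sup>3\<close>, and since
  \<open>W \<rightarrow> \<tau>W/\<tau>Z\<close> and \<open>d : W \<rightarrow> dW/d(W \<inter> F)\<close> are surjective with the same kernel \<open>Z(W \<inter> F)\<close>, its cokernel is
  \<open>dW/d(W \<inter> F)\<close>, where \<open>d(W \<inter> F)\<close> is the denominator of \<open>E\<^sub>2\<^sup>0\<^sup>,\<^sup>4\<close>. If the spectral sequence collapses,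
  then \<open>d\<^sub>3 = 1\<close> on \<open>E\<^sub>3\<^sup>2\<^sup>,\<^sup>1\<close> and \<open>d\<^sub>2 = 1\<close> on \<open>E\<^sub>2\<^sup>1\<^sup>,\<^sup>2\<close> give \<open>dW = d(W \<inter> F)\<close>, while \<open>d\<^sub>2 = 1\<close> on
  \<open>E\<^sub>2\<^sup>1\<^sup>,\<^sup>1\<close> shows that \<open>B \<inter> F\<close> consists of the coboundaries of invariant cochains.\<close>

section \<open>Alternating products\<close>

text \<open>Both differentials are alternating products over the faces 0 to \<open>n\<close> of a
  tuple, so the cancellation arguments are carried out once, at this level.\<close>

definition altprod :: "nat \<Rightarrow> (nat \<Rightarrow> complex) \<Rightarrow> complex" where
  "altprod n f = (\<Prod>i\<le>n. f i powi ((-1) ^ i))"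

lemma altprod_cong:
  "(\<And>i. i \<le> n \<Longrightarrow> f i = g i) \<Longrightarrow> altprod n f = altprod n g"
  by (auto simp: altprod_def intro: prod.cong)

lemma altprod_one [simp]: "altprod n (\<lambda>i. 1) = 1"
  by (simp add: altprod_def)

lemma altprod_mult: "altprod n (\<lambda>i. f i * g i) = altprod n f * altprod n g"
  by (simp add: altprod_def power_int_mult_distrib prod.distrib)

lemma prod_powi: "(\<Prod>i\<in>A. f i) powi m = (\<Prod>i\<in>A. (f i :: complex) powi m)"
  by (induction A rule: infinite_finite_induct) (auto simp: power_int_mult_distrib)

lemma altprod_powi: "altprod n (\<lambda>i. f i powi m) = altprod n f powi m"
  by (simp add: altprod_def prod_powi flip: power_int_mult) (simp add: mult.commute)

lemma altprod_swap:
  "altprod n (\<lambda>i. altprod m (\<lambda>j. f i j)) = altprod m (\<lambda>j. altprod n (\<lambda>i. f i j))"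
  unfolding altprod_def prod_powi power_int_mult [symmetric]
  by (subst prod.swap) (simp add: mult.commute)

lemma norm_altprod:
  "(\<And>i. i \<le> n \<Longrightarrow> cmod (f i) = 1) \<Longrightarrow> cmod (altprod n f) = 1"
  by (simp add: altprod_def norm_power_int flip: prod_norm)

lemma altprod_Suc:
  "altprod (Suc n) f = f 0 * (\<Prod>i = 1..n. f i powi ((-1) ^ i)) * f (Suc n) powi ((-1) ^ Suc n)"
  by (simp add: altprod_def atMost_atLeast0 prod.atLeast_Suc_atMost)

lemma powi_neg_one_power_Suc: "(x::complex) powi ((-1) ^ Suc m) = inverse (x powi ((-1) ^ m))"
  by (simp add: power_int_minus)

text \<open>Factors \<open>m\<close> and \<open>m + 1\<close> carry opposite exponents. This serves
  normalization: a unit at position \<open>m\<close> of a tuple makes the faces \<open>m\<close> and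
  \<open>m + 1\<close> equal and survives in all others.\<close>

lemma altprod_cancel:
  assumes "m < n" "f m = f (Suc m)" "f m \<noteq> 0"
    and "\<And>i. i \<le> n \<Longrightarrow> i \<noteq> m \<Longrightarrow> i \<noteq> Suc m \<Longrightarrow> f i = 1"
  shows "altprod n f = 1"
proof -
  have "altprod n f = (\<Prod>i\<in>{m, Suc m}. f i powi ((-1) ^ i))"
    unfolding altprod_def using assms by (intro prod.mono_neutral_right) auto
  also have "\<dots> = 1"
    using assms(3) by (simp add: assms(2) powi_neg_one_power_Suc del: power_Suc)
  finally show ?thesis .
qed

text \<open>The usual simplicial reason for a differential to square to the trivial map: the pair
  \<open>(j, i)\<close> with \<open>i < j\<close> is matched with \<open>(i, j - 1)\<close>, whose
  exponent has the opposite parity.\<close>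

lemma altprod_simplicial:
  assumes nz: "\<And>i j. i \<le> n \<Longrightarrow> j \<le> Suc n \<Longrightarrow> a j i \<noteq> 0"
    and eq: "\<And>i j. i < j \<Longrightarrow> j \<le> Suc n \<Longrightarrow> a j i = a i (j - 1)"
  shows "altprod (Suc n) (\<lambda>j. altprod n (a j)) = 1"
proof -
  define b where "b = (\<lambda>(j, i). a j i powi ((-1) ^ (i + j)))"
  define A where "A = {(j, i). i < j \<and> j \<le> Suc n}"
  define B where "B = {(j, i). j \<le> i \<and> i \<le> n}"
  have fin: "finite A" "finite B"
    by (rule finite_subset [of _ "{..Suc n} \<times> {..Suc n}"]; auto simp: A_def B_def)+
  have "altprod (Suc n) (\<lambda>j. altprod n (a j)) = (\<Prod>x\<in>{..Suc n} \<times> {..n}. b x)"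
    unfolding altprod_def prod_powi power_int_mult [symmetric] prod.cartesian_product b_def
    by (simp add: power_add)
  also have "{..Suc n} \<times> {..n} = A \<union> B"
    by (auto simp: A_def B_def)
  also have "prod b (A \<union> B) = prod b A * prod b B"
    using fin by (intro prod.union_disjoint) (auto simp: A_def B_def)
  also have "prod b A = (\<Prod>x\<in>B. inverse (b x))"
  proof (rule prod.reindex_bij_witness [where j = "\<lambda>(j, i). (i, j - 1)" and i = "\<lambda>(j, i). (Suc i, j)"])
    fix x assume "x \<in> A"
    then obtain j i where x: "x = (j, i)" "i < j" "j \<le> Suc n"
      by (auto simp: A_def)
    then obtain l where l: "j = Suc l"
      by (cases j) auto
    show "inverse (b (case x of (j, i) \<Rightarrow> (i, j - 1))) = b x"
      using x eq [of i j] by (simp add: l b_def add.commute power_int_minus)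
  qed (auto simp: A_def B_def)
  also have "(\<Prod>x\<in>B. inverse (b x)) * prod b B = 1"
  proof -
    have "prod b B \<noteq> 0"
      using fin nz by (auto simp: B_def b_def)
    moreover have "(\<Prod>x\<in>B. inverse (b x)) = inverse (prod b B)"
      using prod_inversef [of b B] by (simp add: comp_def)
    ultimately show ?thesis
      by simp
  qed
  finally show ?thesis .
qed

section \<open>Faces of tuples\<close>

text \<open>One entrywise formula covers all faces: index 0 drops the first entry, index
  \<open>length xs\<close> the last, and the others merge. Simplicial identities thereby reduce to
  case distinctions on positions.\<close>

definition face :: "('a, 'm) monoid_scheme \<Rightarrow> nat \<Rightarrow> 'a list \<Rightarrow> 'a list" where
  "face M i xs = map (\<lambda>j. if j + 1 < i then xs ! j
     else if j + 1 = i then xs ! j \<otimes>\<^bsub>M\<^esub> xs ! (j + 1) else xs ! (j + 1)) [0..<length xs - 1]"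

lemma length_face [simp]: "length (face M i xs) = length xs - 1"
  by (simp add: face_def)

lemma nth_face:
  "j + 1 < length xs \<Longrightarrow> face M i xs ! j = (if j + 1 < i then xs ! j
     else if j + 1 = i then xs ! j \<otimes>\<^bsub>M\<^esub> xs ! (j + 1) else xs ! (j + 1))"
  by (simp add: face_def less_diff_conv)

lemma face_0: "face M 0 xs = tl xs"
  by (rule nth_equalityI) (auto simp: nth_face nth_tl less_diff_conv)

lemma face_length: "length xs = n \<Longrightarrow> face M n xs = butlast xs"
  by (rule nth_equalityI) (auto simp: nth_face nth_butlast less_diff_conv)

lemma face_merge_at:
  assumes "0 < i" "i < length xs"
  shows "face M i xs = merge_at M i xs"
proof (rule nth_equalityI)
  fix j assume "j < length (face M i xs)"
  moreover have "i - Suc 0 < length xs"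
    using assms by simp
  ultimately show "face M i xs ! j = merge_at M i xs ! j"
    using assms
    by (cases "j + 1 < i"; cases "j + 1 = i")
      (auto simp: nth_face merge_at_def nth_append less_diff_conv nth_Cons' intro!: arg_cong [of _ _ "nth xs"])
qed (use assms in \<open>simp add: merge_at_def\<close>)

lemma tuples_nth: "xs \<in> tuples M n \<Longrightarrow> j < n \<Longrightarrow> xs ! j \<in> carrier M"
  unfolding tuples_def using nth_mem by fastforce

lemma tuplesI: "length xs = n \<Longrightarrow> (\<And>j. j < n \<Longrightarrow> xs ! j \<in> carrier M) \<Longrightarrow> xs \<in> tuples M n"
  by (auto simp: tuples_def in_set_conv_nth)

lemma tuples_length: "xs \<in> tuples M n \<Longrightarrow> length xs = n"
  by (simp add: tuples_def)

context monoid
begin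

lemma face_tuples: "xs \<in> tuples G (Suc n) \<Longrightarrow> face G i xs \<in> tuples G n"
  by (rule tuplesI) (auto simp: nth_face tuples_length tuples_nth [of xs G "Suc n"])

text \<open>Associativity enters only when \<open>j = i + 1\<close> and three neighbouring entries
  are merged.\<close>

lemma face_face:
  assumes xs: "xs \<in> tuples G n" and ij: "i < j" "j \<le> n"
  shows "face G i (face G j xs) = face G (j - 1) (face G i xs)"
proof (rule nth_equalityI)
  have n: "length xs = n"
    using xs by (rule tuples_length)
  fix k assume "k < length (face G i (face G j xs))"
  then have k: "k + 2 < n"
    using n by simp
  have c: "xs ! k \<in> carrier G" "xs ! Suc k \<in> carrier G" "xs ! Suc (Suc k) \<in> carrier G"
    using xs k by (auto intro: tuples_nth)
  consider "k + 1 < i" | "k + 1 = i" | "i < k + 1" "k + 2 < j" | "i < k + 1" "k + 2 = j" | "k + 2 > j"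
    by linarith
  then show "face G i (face G j xs) ! k = face G (j - 1) (face G i xs) ! k"
    by cases (use ij k n c in \<open>auto simp: nth_face m_assoc\<close>)
qed simp

text \<open>In the faces \<open>m\<close> and \<open>m + 1\<close> the unit is absorbed by a
  neighbour, or dropped at an end; every other face keeps it, at position \<open>m - 1\<close> if
  \<open>i < m\<close> and at \<open>m\<close> otherwise.\<close>

lemma face_unit:
  assumes xs: "xs \<in> tuples G n" and m: "m < n" "xs ! m = \<one>"
  shows "face G m xs = face G (Suc m) xs"
    and "i \<le> n \<Longrightarrow> i \<noteq> m \<Longrightarrow> i \<noteq> Suc m \<Longrightarrow> \<one> \<in> set (face G i xs)"
proof -
  have n: "length xs = n"
    using xs by (rule tuples_length)
  show "face G m xs = face G (Suc m) xs"
  proof (rule nth_equalityI)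
    fix k assume "k < length (face G m xs)"
    then have k: "k + 1 < n"
      using n by simp
    have c: "xs ! k \<in> carrier G" "xs ! Suc k \<in> carrier G"
      using xs k by (auto intro: tuples_nth)
    consider "k + 1 < m" | "k + 1 = m" | "k = m" | "k > m"
      by linarith
    then show "face G m xs ! k = face G (Suc m) xs ! k"
      by cases (use k n m c in \<open>auto simp: nth_face\<close>)
  qed simp
  assume i: "i \<le> n" "i \<noteq> m" "i \<noteq> Suc m"
  show "\<one> \<in> set (face G i xs)"
  proof (cases "i < m")
    case True
    then have "face G i xs ! (m - 1) = \<one>"
      using m n by (simp add: nth_face)
    moreover have "m - 1 < length (face G i xs)"
      using True m n by simp
    ultimately show ?thesis
      by (metis nth_mem)
  next
    case False
    then have "face G i xs ! m = \<one>" "m < length (face G i xs)"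
      using m n i by (simp_all add: nth_face)
    then show ?thesis
      by (metis nth_mem)
  qed
qed

end

lemma map_face:
  assumes "h \<in> hom M N" "xs \<in> tuples M n" "i \<le> n"
  shows "map h (face M i xs) = face N i (map h xs)"
proof (rule nth_equalityI)
  fix k assume k: "k < length (map h (face M i xs))"
  then have "xs ! k \<in> carrier M" "xs ! Suc k \<in> carrier M"
    using assms(2) by (auto intro!: tuples_nth [OF assms(2)] dest: tuples_length)
  then show "map h (face M i xs) ! k = face N i (map h xs) ! k"
    using k assms by (auto simp: nth_face hom_mult)
qed simp

section \<open>The differentials of the double complex\<close>

text \<open>The \<open>i\<close>-th \<open>G\<close>-face of \<open>(gs, ks)\<close> is \<open>(face G i gs, gact act i gs ks)\<close>.\<close>

definition gact :: "('g \<Rightarrow> 'k \<Rightarrow> 'k) \<Rightarrow> nat \<Rightarrow> 'g list \<Rightarrow> 'k list \<Rightarrow> 'k list" where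
  "gact act i gs ks = (if i = length gs then map (act (last gs)) ks else ks)"

lemma delta_K_eq:
  assumes "gs \<in> tuples G p" "ks \<in> tuples K (Suc q)"
  shows "delta_K G K p q F gs ks = altprod (Suc q) (\<lambda>j. F gs (face K j ks))"
proof -
  have "length ks = Suc q"
    using assms(2) by (rule tuples_length)
  then show ?thesis
    using assms by (simp add: delta_K_def altprod_Suc face_0 face_length face_merge_at)
qed

lemma delta_G_eq:
  assumes "gs \<in> tuples G (Suc p)" "ks \<in> tuples K q"
  shows "delta_G G K act p q F gs ks = altprod (Suc p) (\<lambda>i. F (face G i gs) (gact act i gs ks))"
proof -
  have "length gs = Suc p"
    using assms(1) by (rule tuples_length)
  then show ?thesis
    using assms by (simp add: delta_G_def altprod_Suc face_0 face_length face_merge_at gact_def)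
qed

lemma delta_K_outside:
  "\<not> (gs \<in> tuples G p \<and> ks \<in> tuples K (Suc q)) \<Longrightarrow> delta_K G K p q F gs ks = 1"
  by (auto simp: delta_K_def)

lemma delta_G_outside:
  "\<not> (gs \<in> tuples G (Suc p) \<and> ks \<in> tuples K q) \<Longrightarrow> delta_G G K act p q F gs ks = 1"
  by (auto simp: delta_G_def)

text \<open>The exponent \<open>m\<close> is there for the sign in \<open>tot_d\<close>;
  \<open>m = 1\<close> gives multiplicativity.\<close>

lemma delta_K_mult_powi:
  "delta_K G K p q (\<lambda>gs ks. F gs ks * F' gs ks powi m) gs ks =
     delta_K G K p q F gs ks * delta_K G K p q F' gs ks powi m"
  by (cases "gs \<in> tuples G p \<and> ks \<in> tuples K (Suc q)")
    (simp_all add: delta_K_eq delta_K_outside altprod_mult altprod_powi)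

lemma delta_G_mult_powi:
  "delta_G G K act p q (\<lambda>gs ks. F gs ks * F' gs ks powi m) gs ks =
     delta_G G K act p q F gs ks * delta_G G K act p q F' gs ks powi m"
  by (cases "gs \<in> tuples G (Suc p) \<and> ks \<in> tuples K q")
    (simp_all add: delta_G_eq delta_G_outside altprod_mult altprod_powi)

lemma delta_K_one [simp]: "delta_K G K p q (\<lambda>gs ks. 1) = (\<lambda>gs ks. 1)"
  by (intro ext) (simp add: delta_K_def)

lemma delta_G_one [simp]: "delta_G G K act p q (\<lambda>gs ks. 1) = (\<lambda>gs ks. 1)"
  by (intro ext) (simp add: delta_G_def)

lemma cochains_norm:
  "F \<in> carrier (cochains G K p q) \<Longrightarrow> gs \<in> tuples G p \<Longrightarrow> ks \<in> tuples K q \<Longrightarrow> cmod (F gs ks) = 1"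
  by (auto simp: cochains_def)

lemma cochains_unit:
  "F \<in> carrier (cochains G K p q) \<Longrightarrow> \<one>\<^bsub>G\<^esub> \<in> set gs \<or> \<one>\<^bsub>K\<^esub> \<in> set ks \<Longrightarrow> F gs ks = 1"
  by (auto simp: cochains_def)

lemma cochains_outside:
  "F \<in> carrier (cochains G K p q) \<Longrightarrow> \<not> (gs \<in> tuples G p \<and> ks \<in> tuples K q) \<Longrightarrow> F gs ks = 1"
  by (auto simp: cochains_def)

lemma cochains_nonzero: "F \<in> carrier (cochains G K p q) \<Longrightarrow> F gs ks \<noteq> 0"
  by (metis cochains_norm cochains_outside norm_zero zero_neq_one)

lemma one_cochains: "(\<lambda>gs ks. 1) \<in> carrier (cochains G K p q)"
  by (simp add: cochains_def)

lemma cochains_mult_powi: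
  assumes "F \<in> carrier (cochains G K p q)" "F' \<in> carrier (cochains G K p q)"
  shows "(\<lambda>gs ks. F gs ks * F' gs ks powi m) \<in> carrier (cochains G K p q)"
  using assms by (auto simp: cochains_def norm_mult norm_power_int)

lemma cochains_inverse:
  "F \<in> carrier (cochains G K p q) \<Longrightarrow> (\<lambda>gs ks. inverse (F gs ks)) \<in> carrier (cochains G K p q)"
  by (auto simp: cochains_def norm_inverse)

section \<open>The action of G on tuples over K\<close>

context equivariant_monoid
begin

lemma group_G: "group G"
  using group_hom by (rule group_hom.axioms)

lemma act_closed: "g \<in> carrier G \<Longrightarrow> k \<in> carrier K \<Longrightarrow> act g k \<in> carrier K"
  by (rule element_image) auto

lemma act_mult: "g \<in> carrier G \<Longrightarrow> h \<in> carrier G \<Longrightarrow> k \<in> carrier K \<Longrightarrow>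
    act (g \<otimes>\<^bsub>G\<^esub> h) k = act g (act h k)"
  by (rule composition_rule)

lemma act_one: "k \<in> carrier K \<Longrightarrow> act \<one>\<^bsub>G\<^esub> k = k"
  by (metis id_eq_one restrict_apply)

text \<open>A surjective multiplicative map preserves the unit: if \<open>act g e = 1\<close>, then
  \<open>act g 1 = act g 1 * act g e = act g e = 1\<close>.\<close>

lemma act_unit:
  assumes g: "g \<in> carrier G"
  shows "act g \<one>\<^bsub>K\<^esub> = \<one>\<^bsub>K\<^esub>"
proof -
  interpret G: group G by (rule group_G)
  define e where "e = act (inv\<^bsub>G\<^esub> g) \<one>\<^bsub>K\<^esub>"
  have e: "e \<in> carrier K"
    using g by (simp add: e_def act_closed)
  have ge: "act g e = \<one>\<^bsub>K\<^esub>"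
    using g by (simp add: e_def act_one flip: act_mult)
  have "act g \<one>\<^bsub>K\<^esub> = act g \<one>\<^bsub>K\<^esub> \<otimes>\<^bsub>K\<^esub> act g e"
    using g by (simp add: ge act_closed)
  also have "\<dots> = act g (\<one>\<^bsub>K\<^esub> \<otimes>\<^bsub>K\<^esub> e)"
    using hom_mult [OF act_hom [OF g] K.one_closed e] by simp
  finally show ?thesis
    using e ge by simp
qed

lemma map_act_tuples: "g \<in> carrier G \<Longrightarrow> ks \<in> tuples K q \<Longrightarrow> map (act g) ks \<in> tuples K q"
  by (auto simp: tuples_def act_closed)

lemma gact_tuples:
  assumes "gs \<in> tuples G (Suc p)" "ks \<in> tuples K q"
  shows "gact act i gs ks \<in> tuples K q"
proof -
  have "last gs \<in> carrier G"
    using assms(1) by (cases gs rule: rev_cases) (auto simp: tuples_def)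
  then show ?thesis
    using assms by (simp add: gact_def map_act_tuples)
qed

lemma gact_unit:
  assumes "gs \<in> tuples G (Suc p)" "\<one>\<^bsub>K\<^esub> \<in> set ks"
  shows "\<one>\<^bsub>K\<^esub> \<in> set (gact act i gs ks)"
proof -
  have "last gs \<in> carrier G"
    using assms(1) by (cases gs rule: rev_cases) (auto simp: tuples_def)
  from act_unit [OF this] show ?thesis
    using assms(2) by (force simp: gact_def)
qed

lemma gact_face_K:
  assumes "gs \<in> tuples G (Suc p)" "ks \<in> tuples K q" "j \<le> q"
  shows "gact act i gs (face K j ks) = face K j (gact act i gs ks)"
proof -
  have "last gs \<in> carrier G"
    using assms(1) by (cases gs rule: rev_cases) (auto simp: tuples_def)
  from map_face [OF act_hom [OF this] assms(2,3)] show ?thesis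
    by (simp add: gact_def)
qed

text \<open>The K-component of the simplicial identity for G-faces. The substantial case is
  \<open>i = p + 1\<close>, \<open>j = p + 2\<close>: acting by the last entry of \<open>gs\<close>
  and then by the one before it is acting by their product.\<close>

lemma gact_gact:
  assumes gs: "gs \<in> tuples G (Suc (Suc p))" and ks: "ks \<in> tuples K q" and ij: "i < j" "j \<le> Suc (Suc p)"
  shows "gact act i (face G j gs) (gact act j gs ks) = gact act (j - 1) (face G i gs) (gact act i gs ks)"
proof -
  have n: "length gs = Suc (Suc p)"
    using gs by (rule tuples_length)
  then have last: "last gs = gs ! Suc p" "last (face G k gs) = face G k gs ! p" for k
    by (auto simp: last_conv_nth simp flip: length_0_conv)
  have c: "gs ! p \<in> carrier G" "gs ! Suc p \<in> carrier G"
    using gs by (auto intro: tuples_nth)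
  have "map (act (gs ! p)) (map (act (gs ! Suc p)) ks) = map (act (gs ! p \<otimes>\<^bsub>G\<^esub> gs ! Suc p)) ks"
    using ks c by (auto simp: tuples_def act_mult)
  then show ?thesis
    using n ij by (auto simp: gact_def last nth_face)
qed

section \<open>Closure of normalized cochains under the differentials\<close>

lemma delta_K_closed:
  assumes F: "F \<in> carrier (cochains G K p q)"
  shows "delta_K G K p q F \<in> carrier (cochains G K p (Suc q))"
proof -
  have "cmod (delta_K G K p q F gs ks) = 1"
    if "gs \<in> tuples G p" "ks \<in> tuples K (Suc q)" for gs ks
    using that by (auto simp: delta_K_eq intro!: norm_altprod cochains_norm [OF F] K.face_tuples)
  moreover have "delta_K G K p q F gs ks = 1"
    if t: "gs \<in> tuples G p" "ks \<in> tuples K (Suc q)" and one: "\<one>\<^bsub>G\<^esub> \<in> set gs \<or> \<one>\<^bsub>K\<^esub> \<in> set ks" for gs ks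
  proof (cases "\<one>\<^bsub>G\<^esub> \<in> set gs")
    case True
    then show ?thesis
      using t by (simp add: delta_K_eq cochains_unit [OF F])
  next
    case False
    with one t obtain m where m: "m < Suc q" "ks ! m = \<one>\<^bsub>K\<^esub>"
      by (metis in_set_conv_nth tuples_length)
    show ?thesis
      unfolding delta_K_eq [OF t]
      by (rule altprod_cancel [of m])
        (use m K.face_unit [OF t(2) m] cochains_nonzero [OF F] in \<open>auto intro!: cochains_unit [OF F]\<close>)
  qed
  ultimately show ?thesis
    by (auto simp: cochains_def delta_K_outside)
qed

lemma delta_G_closed:
  assumes F: "F \<in> carrier (cochains G K p q)"
  shows "delta_G G K act p q F \<in> carrier (cochains G K (Suc p) q)"
proof -
  interpret G: group G by (rule group_G)
  have "cmod (delta_G G K act p q F gs ks) = 1"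
    if "gs \<in> tuples G (Suc p)" "ks \<in> tuples K q" for gs ks
    using that by (auto simp: delta_G_eq intro!: norm_altprod cochains_norm [OF F] G.face_tuples gact_tuples)
  moreover have "delta_G G K act p q F gs ks = 1"
    if t: "gs \<in> tuples G (Suc p)" "ks \<in> tuples K q" and one: "\<one>\<^bsub>G\<^esub> \<in> set gs \<or> \<one>\<^bsub>K\<^esub> \<in> set ks" for gs ks
  proof (cases "\<one>\<^bsub>K\<^esub> \<in> set ks")
    case True
    then show ?thesis
      using t gact_unit [OF t(1)] by (simp add: delta_G_eq cochains_unit [OF F])
  next
    case False
    with one t obtain m where m: "m < Suc p" "gs ! m = \<one>\<^bsub>G\<^esub>"
      by (metis in_set_conv_nth tuples_length)
    \<comment> \<open>The faces \<open>m\<close> and \<open>m + 1\<close> have to agree on the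
      K-entries too. Only face \<open>m + 1\<close> with \<open>m = p\<close> acts on them, and it
      acts by \<open>gs ! m\<close>, the unit.\<close>
    have "gact act i gs ks = ks" if "i = m \<or> i = Suc m" for i
    proof -
      have "last gs = gs ! p" "length gs = Suc p"
        using tuples_length [OF t(1)] by (auto simp: last_conv_nth simp flip: length_0_conv)
      moreover have "map (act \<one>\<^bsub>G\<^esub>) ks = ks"
        using t(2) by (intro map_idI) (auto simp: tuples_def act_one)
      ultimately show ?thesis
        using that m by (auto simp: gact_def)
    qed
    then have "gact act m gs ks = ks" "gact act (Suc m) gs ks = ks"
      by auto
    then show ?thesis
      unfolding delta_G_eq [OF t]
      by (intro altprod_cancel [of m])
        (use m G.face_unit [OF t(1) m] cochains_nonzero [OF F] in \<open>auto intro!: cochains_unit [OF F]\<close>)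
  qed
  ultimately show ?thesis
    by (auto simp: cochains_def delta_G_outside)
qed

section \<open>Relations between the two differentials\<close>

lemma delta_K_delta_K:
  assumes F: "F \<in> carrier (cochains G K p q)"
  shows "delta_K G K p (Suc q) (delta_K G K p q F) gs ks = 1"
proof (cases "gs \<in> tuples G p \<and> ks \<in> tuples K (Suc (Suc q))")
  case True
  then have "delta_K G K p (Suc q) (delta_K G K p q F) gs ks =
      altprod (Suc (Suc q)) (\<lambda>j. altprod (Suc q) (\<lambda>i. F gs (face K i (face K j ks))))"
    by (auto simp: delta_K_eq K.face_tuples)
  also have "\<dots> = 1"
    by (rule altprod_simplicial) (use True in \<open>auto simp: cochains_nonzero [OF F] K.face_face\<close>)
  finally show ?thesis .
qed (simp add: delta_K_outside)

lemma delta_G_delta_G: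
  assumes F: "F \<in> carrier (cochains G K p q)"
  shows "delta_G G K act (Suc p) q (delta_G G K act p q F) gs ks = 1"
proof (cases "gs \<in> tuples G (Suc (Suc p)) \<and> ks \<in> tuples K q")
  case True
  interpret G: group G by (rule group_G)
  have "delta_G G K act (Suc p) q (delta_G G K act p q F) gs ks =
      altprod (Suc (Suc p)) (\<lambda>j. altprod (Suc p) (\<lambda>i.
        F (face G i (face G j gs)) (gact act i (face G j gs) (gact act j gs ks))))"
    using True by (auto simp: delta_G_eq G.face_tuples gact_tuples)
  also have "\<dots> = 1"
  proof (rule altprod_simplicial)
    fix i j assume "i < j" "j \<le> Suc (Suc p)"
    then show "F (face G i (face G j gs)) (gact act i (face G j gs) (gact act j gs ks)) =
        F (face G (j - 1) (face G i gs)) (gact act (j - 1) (face G i gs) (gact act i gs ks))"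
      using True G.face_face [of gs "Suc (Suc p)" i j] gact_gact [of gs p ks q i j] by simp
  qed (rule cochains_nonzero [OF F])
  finally show ?thesis .
qed (simp add: delta_G_outside)

text \<open>G acts by homomorphisms, so G-faces commute with K-faces and the two alternating
  products can be interchanged. The squares commute; it is the sign in \<open>tot_d\<close> that
  makes the mixed terms cancel.\<close>

lemma delta_G_delta_K:
  "delta_G G K act p (Suc q) (delta_K G K p q F) gs ks = delta_K G K (Suc p) q (delta_G G K act p q F) gs ks"
proof (cases "gs \<in> tuples G (Suc p) \<and> ks \<in> tuples K (Suc q)")
  case True
  interpret G: group G by (rule group_G)
  have "delta_G G K act p (Suc q) (delta_K G K p q F) gs ks =
      altprod (Suc p) (\<lambda>i. altprod (Suc q) (\<lambda>j. F (face G i gs) (face K j (gact act i gs ks))))"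
    using True by (auto simp: delta_G_eq delta_K_eq G.face_tuples gact_tuples)
  also have "\<dots> = altprod (Suc q) (\<lambda>j. altprod (Suc p) (\<lambda>i. F (face G i gs) (face K j (gact act i gs ks))))"
    by (rule altprod_swap)
  also have "\<dots> = delta_K G K (Suc p) q (delta_G G K act p q F) gs ks"
    using True by (auto simp: delta_G_eq delta_K_eq K.face_tuples gact_face_K intro!: altprod_cong)
  finally show ?thesis .
qed (auto simp: delta_G_outside delta_K_outside)

end

section \<open>Subquotients of commutative groups\<close>

text \<open>Cohomology groups, \<open>MS\<close> and the entries of the pages all have this
  form.\<close>

abbreviation subquot :: "('a, 'm) monoid_scheme \<Rightarrow> 'a set \<Rightarrow> 'a set \<Rightarrow> 'a set monoid" where
  "subquot M Z B \<equiv> M\<lparr>carrier := Z\<rparr> Mod B"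

lemma r_coset_update [simp]: "B #>\<^bsub>M\<lparr>carrier := Z\<rparr>\<^esub> x = B #>\<^bsub>M\<^esub> x"
  by (simp add: r_coset_def)

lemma set_mult_update [simp]: "X <#>\<^bsub>M\<lparr>carrier := Z\<rparr>\<^esub> Y = X <#>\<^bsub>M\<^esub> Y"
  by (simp add: set_mult_def)

lemma carrier_subquot: "carrier (subquot M Z B) = (\<lambda>x. B #>\<^bsub>M\<^esub> x) ` Z"
  by (simp add: carrier_FactGroup)

text \<open>\<open>MS\<close> and \<open>d3_plus_d2\<close> restrict the carrier of a quotient; this
  turns them into quotients of a smaller subgroup by the same \<open>B\<close>.\<close>

lemma subquot_subset:
  "(subquot M Z B)\<lparr>carrier := (\<lambda>x. B #>\<^bsub>M\<^esub> x) ` Y\<rparr> = subquot M Y B"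
  by (simp add: FactGroup_def carrier_subquot RCOSETS_def set_mult_def fun_eq_iff) auto

context comm_group
begin

lemma comm_group_subgroup: "subgroup Z G \<Longrightarrow> comm_group (G\<lparr>carrier := Z\<rparr>)"
  by (intro group.group_comm_groupI subgroup_imp_group)
    (auto intro: m_comm dest: subgroup.mem_carrier)

lemma comm_group_subquot:
  assumes "subgroup Z G" "subgroup B G" "B \<subseteq> Z"
  shows "comm_group (subquot G Z B)"
  using assms by (intro comm_group.abelian_FactGroup comm_group_subgroup subgroup_incl)

lemma coset_hom:
  assumes "subgroup Z G" "subgroup B G" "B \<subseteq> Z"
  shows "(\<lambda>x. B #> x) \<in> hom (G\<lparr>carrier := Z\<rparr>) (subquot G Z B)"
proof -
  have "B \<lhd> G\<lparr>carrier := Z\<rparr>"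
    using assms by (intro comm_group.subgroup_imp_normal comm_group_subgroup subgroup_incl)
  from normal.r_coset_hom_Mod [OF this] show ?thesis
    by (simp add: fun_eq_iff)
qed

lemma coset_eq_iff:
  assumes "subgroup B G" "x \<in> carrier G" "y \<in> carrier G"
  shows "B #> x = B #> y \<longleftrightarrow> (\<exists>b\<in>B. x = b \<otimes> y)"
proof
  assume "B #> x = B #> y"
  then have "x \<in> B #> y"
    using assms by (metis rcos_self)
  then show "\<exists>b\<in>B. x = b \<otimes> y"
    by (auto simp: r_coset_def)
next
  assume "\<exists>b\<in>B. x = b \<otimes> y"
  then have "x \<in> B #> y"
    by (auto simp: r_coset_def)
  then show "B #> x = B #> y"
    using assms by (metis repr_independence)
qed

lemma coset_eq_self_iff:
  assumes "subgroup B G" "x \<in> carrier G"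
  shows "B #> x = B \<longleftrightarrow> x \<in> B"
  using assms by (metis coset_join1 coset_join2)

end

lemma subgroup_image:
  assumes "group M" "group N" "h \<in> hom M N" "subgroup X M"
  shows "subgroup (h ` X) N"
  using assms by (intro group_hom.subgroup_img_is_subgroup) (auto simp: group_hom_def group_hom_axioms_def)

text \<open>Since \<open>h\<close> maps \<open>B\<close> into \<open>B'\<close>, the image of a
  coset of \<open>B\<close> lies in a single coset of \<open>B'\<close>; since \<open>x\<close> is
  in its own coset, all of that coset is reached. So weak a condition on \<open>B\<close> fits the
  denominator \<open>ss_B\<close> of a page as it stands.\<close>

lemma induced_coset:
  assumes N: "comm_group N" and h: "h \<in> hom M N" and B: "B \<subseteq> carrier M" "\<one>\<^bsub>M\<^esub> \<in> B"
    and B': "subgroup B' N" "h ` B \<subseteq> B'" and x: "x \<in> carrier M" and M: "group M"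
  shows "induced N B' h (B #>\<^bsub>M\<^esub> x) = B' #>\<^bsub>N\<^esub> h x"
proof -
  interpret N: comm_group N by fact
  interpret B': subgroup B' N by fact
  have hx: "h x \<in> carrier N"
    using h x by (auto simp: hom_def)
  show ?thesis
  proof (intro equalityI subsetI)
    fix y assume "y \<in> induced N B' h (B #>\<^bsub>M\<^esub> x)"
    then obtain b' b where b: "b' \<in> B'" "b \<in> B" "y = b' \<otimes>\<^bsub>N\<^esub> h (b \<otimes>\<^bsub>M\<^esub> x)"
      by (auto simp: induced_def set_mult_def r_coset_def)
    then have "h b \<in> B'" "h (b \<otimes>\<^bsub>M\<^esub> x) = h b \<otimes>\<^bsub>N\<^esub> h x"
      using B B' h x by (auto simp: hom_mult)
    with b hx have "y = (b' \<otimes>\<^bsub>N\<^esub> h b) \<otimes>\<^bsub>N\<^esub> h x" "b' \<otimes>\<^bsub>N\<^esub> h b \<in> B'"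
      by (auto simp: N.m_assoc)
    then show "y \<in> B' #>\<^bsub>N\<^esub> h x"
      by (auto simp: r_coset_def)
  next
    fix y assume "y \<in> B' #>\<^bsub>N\<^esub> h x"
    then obtain b' where "b' \<in> B'" "y = b' \<otimes>\<^bsub>N\<^esub> h x"
      by (auto simp: r_coset_def)
    moreover have "x \<in> B #>\<^bsub>M\<^esub> x"
      using B x M by (force simp: r_coset_def group.is_monoid monoid.l_one)
    ultimately show "y \<in> induced N B' h (B #>\<^bsub>M\<^esub> x)"
      unfolding induced_def set_mult_def by blast
  qed
qed

lemma induced_hom:
  assumes M: "comm_group M" and N: "comm_group N" and h: "h \<in> hom M N"
    and Z: "subgroup Z M" "subgroup B M" "B \<subseteq> Z"
    and Z': "subgroup Z' N" "subgroup B' N" "B' \<subseteq> Z'" and hZ: "h ` Z \<subseteq> Z'" "h ` B \<subseteq> B'"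
  shows "induced N B' h \<in> hom (subquot M Z B) (subquot N Z' B')"
proof -
  interpret M: comm_group M by fact
  interpret N: comm_group N by fact
  interpret Z: subgroup Z M by fact
  interpret B: subgroup B M by fact
  have eq: "induced N B' h (B #>\<^bsub>M\<^esub> x) = B' #>\<^bsub>N\<^esub> h x" if "x \<in> Z" for x
    using that by (intro induced_coset N h Z' hZ M.is_group) auto
  have p: "B #>\<^bsub>M\<^esub> (x \<otimes>\<^bsub>M\<^esub> y) = (B #>\<^bsub>M\<^esub> x) <#>\<^bsub>M\<^esub> (B #>\<^bsub>M\<^esub> y)" if "x \<in> Z" "y \<in> Z" for x y
    using hom_mult [OF M.coset_hom [OF Z]] that by simp
  have p': "B' #>\<^bsub>N\<^esub> (x \<otimes>\<^bsub>N\<^esub> y) = (B' #>\<^bsub>N\<^esub> x) <#>\<^bsub>N\<^esub> (B' #>\<^bsub>N\<^esub> y)" if "x \<in> Z'" "y \<in> Z'" for x y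
    using hom_mult [OF N.coset_hom [OF Z']] that by simp
  have hh: "h (x \<otimes>\<^bsub>M\<^esub> y) = h x \<otimes>\<^bsub>N\<^esub> h y" if "x \<in> Z" "y \<in> Z" for x y
    using that by (auto intro: hom_mult [OF h])
  have hZ1: "h x \<in> Z'" if "x \<in> Z" for x
    using hZ that by blast
  show ?thesis
    by (rule homI) (auto simp: carrier_subquot eq hZ1 hh p' simp flip: p)
qed

text \<open>For the total complex, \<open>\<tau>\<close> is the truncation, \<open>W\<close> consists of the cochains \<open>\<alpha> \<oplus> \<beta> \<oplus> \<theta>\<close> with
  differential in \<open>A\<^sup>0\<^sup>,\<^sup>4\<close>, and \<open>B\<close> of the coboundaries.\<close>

locale truncated_complex =
  M: comm_group M + N: comm_group N + L: comm_group L
  for M :: "('a, 'm) monoid_scheme" and N :: "('b, 'n) monoid_scheme" and L :: "('c, 'l) monoid_scheme" +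
  fixes \<tau> :: "'a \<Rightarrow> 'b" and d :: "'a \<Rightarrow> 'c" and W B :: "'a set"
  assumes \<tau>: "\<tau> \<in> hom M N" and d: "d \<in> hom M L"
    and W: "subgroup W M" and B: "subgroup B M" and B_Z: "B \<subseteq> kernel M L d" and Z_W: "kernel M L d \<subseteq> W"
begin

abbreviation Z where "Z \<equiv> kernel M L d"
abbreviation F where "F \<equiv> kernel M N \<tau>"
abbreviation \<phi> where "\<phi> \<equiv> induced N (\<tau> ` B) \<tau>"
abbreviation HZ where "HZ \<equiv> subquot M Z B"
abbreviation HW where "HW \<equiv> subquot N (\<tau> ` W) (\<tau> ` B)"

lemma group_hom_\<tau>: "group_hom M N \<tau>"
  and group_hom_d: "group_hom M L d"
  using \<tau> d by (auto simp: group_hom_def group_hom_axioms_def)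

lemma subgroups:
  "subgroup Z M" "subgroup F M" "subgroup (Z \<inter> F) M" "subgroup (B \<inter> F) M" "subgroup (W \<inter> F) M"
  "subgroup (\<tau> ` W) N" "subgroup (\<tau> ` B) N" "subgroup (d ` W) L" "subgroup (d ` (W \<inter> F)) L"
proof -
  show Z: "subgroup Z M" and F: "subgroup F M"
    by (intro group_hom.subgroup_kernel group_hom_\<tau> group_hom_d)+
  show "subgroup (Z \<inter> F) M" "subgroup (B \<inter> F) M" and WF: "subgroup (W \<inter> F) M"
    by (intro M.subgroups_Inter_pair Z F B W)+
  show "subgroup (\<tau> ` W) N" "subgroup (\<tau> ` B) N" "subgroup (d ` W) L" "subgroup (d ` (W \<inter> F)) L"
    by (intro subgroup_image [OF _ _ \<tau>] subgroup_image [OF _ _ d] W B WF M.is_group N.is_group L.is_group)+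
qed

lemma comm_group_HZ: "comm_group HZ"
  by (intro M.comm_group_subquot subgroups B B_Z)

lemma comm_group_HW: "comm_group HW"
  using B_Z Z_W by (intro N.comm_group_subquot subgroups) auto

lemma mult_inv_kernel:
  assumes "x \<in> carrier M" "y \<in> carrier M"
  shows "\<tau> x = \<tau> y \<Longrightarrow> inv\<^bsub>M\<^esub> y \<otimes>\<^bsub>M\<^esub> x \<in> F" "d x = d y \<Longrightarrow> inv\<^bsub>M\<^esub> y \<otimes>\<^bsub>M\<^esub> x \<in> Z"
proof -
  have "\<tau> (inv\<^bsub>M\<^esub> y \<otimes>\<^bsub>M\<^esub> x) = inv\<^bsub>N\<^esub> \<tau> y \<otimes>\<^bsub>N\<^esub> \<tau> x" "\<tau> x \<in> carrier N"
    using assms group_hom.hom_inv [OF group_hom_\<tau>] by (simp_all add: hom_mult [OF \<tau>] hom_in_carrier [OF \<tau>])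
  then show "\<tau> x = \<tau> y \<Longrightarrow> inv\<^bsub>M\<^esub> y \<otimes>\<^bsub>M\<^esub> x \<in> F"
    using assms by (simp add: kernel_def)
  have "d (inv\<^bsub>M\<^esub> y \<otimes>\<^bsub>M\<^esub> x) = inv\<^bsub>L\<^esub> d y \<otimes>\<^bsub>L\<^esub> d x" "d x \<in> carrier L"
    using assms group_hom.hom_inv [OF group_hom_d] by (simp_all add: hom_mult [OF d] hom_in_carrier [OF d])
  then show "d x = d y \<Longrightarrow> inv\<^bsub>M\<^esub> y \<otimes>\<^bsub>M\<^esub> x \<in> Z"
    using assms by (simp add: kernel_def)
qed

lemma kernel_eq_one [simp]: "x \<in> Z \<Longrightarrow> d x = \<one>\<^bsub>L\<^esub>" "x \<in> F \<Longrightarrow> \<tau> x = \<one>\<^bsub>N\<^esub>"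
  by (simp_all add: kernel_def)

lemma mem_carrier [simp]:
  "x \<in> Z \<Longrightarrow> x \<in> carrier M" "x \<in> B \<Longrightarrow> x \<in> carrier M" "x \<in> W \<Longrightarrow> x \<in> carrier M" "x \<in> F \<Longrightarrow> x \<in> carrier M"
  using subgroup.subset [OF W] subgroup.subset [OF B] by (auto simp: kernel_def simp del: kernel_eq_one)

lemma closed [simp]:
  "x \<in> carrier M \<Longrightarrow> \<tau> x \<in> carrier N" "x \<in> carrier M \<Longrightarrow> d x \<in> carrier L"
  using \<tau> d by (auto simp: hom_def)

lemma \<phi>_coset: "x \<in> carrier M \<Longrightarrow> \<phi> (B #>\<^bsub>M\<^esub> x) = \<tau> ` B #>\<^bsub>N\<^esub> \<tau> x"
  by (intro induced_coset \<tau> subgroups N.comm_group_axioms M.is_group)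
    (auto intro: subgroup.one_closed [OF B])

lemma \<phi>_hom: "\<phi> \<in> hom HZ HW"
  using B_Z Z_W
  by (intro induced_hom \<tau> subgroups B N.comm_group_axioms M.comm_group_axioms) auto

lemma group_hom_\<phi>: "group_hom HZ HW \<phi>"
  using \<phi>_hom comm_group_HZ comm_group_HW
  by (auto simp: group_hom_def group_hom_axioms_def comm_group_def)

lemma kernel_\<phi>: "kernel HZ HW \<phi> = (\<lambda>x. B #>\<^bsub>M\<^esub> x) ` (Z \<inter> F)"
proof (intro equalityI subsetI)
  fix X assume "X \<in> kernel HZ HW \<phi>"
  then obtain x where x: "x \<in> Z" "X = B #>\<^bsub>M\<^esub> x" "\<tau> ` B #>\<^bsub>N\<^esub> \<tau> x = \<tau> ` B"
    by (auto simp: kernel_def [of HZ] carrier_subquot \<phi>_coset)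
  then obtain b where b: "b \<in> B" "\<tau> x = \<tau> b"
    by (auto simp: N.coset_eq_self_iff subgroups)
  \<comment> \<open>\<open>x\<close> and \<open>b\<close> have the same truncation, so dividing by
    the coboundary \<open>b\<close> moves \<open>x\<close> within its class into
    \<open>F\<close>.\<close>
  define y where "y = inv\<^bsub>M\<^esub> b \<otimes>\<^bsub>M\<^esub> x"
  have x_eq: "x = b \<otimes>\<^bsub>M\<^esub> y"
    using x b by (simp add: y_def flip: M.m_assoc)
  have "y \<in> F"
    unfolding y_def using x b by (intro mult_inv_kernel) auto
  moreover have "y \<in> Z"
    unfolding y_def using x b B_Z
    by (intro subgroup.m_closed subgroup.m_inv_closed subgroups) auto
  moreover have "B #>\<^bsub>M\<^esub> x = B #>\<^bsub>M\<^esub> y"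
    using x b x_eq \<open>y \<in> Z\<close> by (subst M.coset_eq_iff) (auto simp: B)
  ultimately show "X \<in> (\<lambda>x. B #>\<^bsub>M\<^esub> x) ` (Z \<inter> F)"
    using x by auto
next
  fix X assume "X \<in> (\<lambda>x. B #>\<^bsub>M\<^esub> x) ` (Z \<inter> F)"
  then obtain x where x: "x \<in> Z" "x \<in> F" "X = B #>\<^bsub>M\<^esub> x"
    by blast
  then have "\<phi> X = \<tau> ` B #>\<^bsub>N\<^esub> \<one>\<^bsub>N\<^esub>"
    by (subst x(3), subst \<phi>_coset) auto
  also have "\<dots> = \<tau> ` B"
    by (intro N.coset_mult_one subgroup.subset subgroups)
  finally show "X \<in> kernel HZ HW \<phi>"
    using x by (auto simp: kernel_def [of HZ] carrier_subquot)
qed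

text \<open>First isomorphism theorem for the coset map from \<open>Z \<inter> F\<close> to the
  kernel of \<open>\<phi>\<close>: it is onto by \<open>kernel_\<phi>\<close> and trivial exactly on
  \<open>B \<inter> F\<close>.\<close>

lemma kernel_\<phi>_iso: "HZ\<lparr>carrier := kernel HZ HW \<phi>\<rparr> \<cong> subquot M (Z \<inter> F) (B \<inter> F)"
proof -
  let ?A = "M\<lparr>carrier := Z \<inter> F\<rparr>" and ?C = "HZ\<lparr>carrier := kernel HZ HW \<phi>\<rparr>" and ?h = "\<lambda>x. B #>\<^bsub>M\<^esub> x"
  have "?h \<in> hom ?A ?C"
    using hom_mult [OF M.coset_hom [OF subgroups(1) B B_Z]]
    by (intro homI) (auto simp: kernel_\<phi>)
  moreover have A: "group ?A"
    by (intro M.subgroup_imp_group subgroups)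
  moreover have "group ?C"
    by (intro group.subgroup_imp_group group_hom.subgroup_kernel group_hom_\<phi>
      comm_group.axioms(2) comm_group_HZ)
  ultimately have h: "group_hom ?A ?C ?h"
    by (simp add: group_hom_def group_hom_axioms_def)
  have "kernel ?A ?C ?h = {x \<in> Z \<inter> F. B #>\<^bsub>M\<^esub> x = B}"
    by (simp add: kernel_def [of ?A])
  also have "\<dots> = {x \<in> Z \<inter> F. x \<in> B}"
    by (intro Collect_cong conj_cong refl M.coset_eq_self_iff B) auto
  also have "\<dots> = B \<inter> F"
    using B_Z by auto
  finally have "kernel ?A ?C ?h = B \<inter> F" .
  moreover have "?A Mod kernel ?A ?C ?h \<cong> ?C"
    by (intro group_hom.FactGroup_iso h) (simp add: kernel_\<phi>)
  moreover have "group (?A Mod kernel ?A ?C ?h)"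
    by (intro normal.factorgroup_is_group group_hom.normal_kernel h)
  ultimately show ?thesis
    using group.iso_sym by metis
qed

lemma coker_\<phi>_iso: "HW Mod (\<phi> ` carrier HZ) \<cong> subquot L (d ` W) (d ` (W \<inter> F))"
proof -
  let ?A = "M\<lparr>carrier := W\<rparr>" and ?I = "\<phi> ` carrier HZ" and ?C = "subquot L (d ` W) (d ` (W \<inter> F))"
  interpret HW: comm_group HW by (rule comm_group_HW)
  have I: "subgroup ?I HW"
    by (intro group_hom.img_is_subgroup group_hom_\<phi>)
  have W_carr: "W \<subseteq> carrier M"
    by auto
  have A: "group ?A"
    by (intro M.subgroup_imp_group W)
  have I_eq: "?I = (\<lambda>x. \<tau> ` B #>\<^bsub>N\<^esub> \<tau> x) ` Z"
    by (auto simp: carrier_subquot \<phi>_coset image_image)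
  have BW: "\<tau> ` B \<subseteq> \<tau> ` W"
    using B_Z Z_W by auto
  \<comment> \<open>Both maps are surjections from \<open>W\<close>, \<open>?p\<close> onto the
    cokernel and \<open>?q\<close> onto the quotient of images under \<open>d\<close>; it remains to
    see that their kernels are equal.\<close>
  let ?p = "\<lambda>x. ?I #>\<^bsub>HW\<^esub> (\<tau> ` B #>\<^bsub>N\<^esub> \<tau> x)" and ?q = "\<lambda>x. d ` (W \<inter> F) #>\<^bsub>L\<^esub> d x"
  have "\<tau> \<in> hom ?A (N\<lparr>carrier := \<tau> ` W\<rparr>)"
    using hom_mult [OF \<tau>] by (intro homI) auto
  moreover have "(\<lambda>x. \<tau> ` B #>\<^bsub>N\<^esub> x) \<in> hom (N\<lparr>carrier := \<tau> ` W\<rparr>) HW"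
    by (intro N.coset_hom subgroups BW)
  moreover have "(\<lambda>x. ?I #>\<^bsub>HW\<^esub> x) \<in> hom HW (HW Mod ?I)"
    by (intro normal.r_coset_hom_Mod HW.subgroup_imp_normal I)
  ultimately have "?p \<in> hom ?A (HW Mod ?I)"
    using hom_compose [OF hom_compose] unfolding comp_def by blast
  then have p: "group_hom ?A (HW Mod ?I) ?p"
    using A HW.abelian_FactGroup [OF I] by (auto simp: group_hom_def group_hom_axioms_def comm_group_def)
  have "d \<in> hom ?A (L\<lparr>carrier := d ` W\<rparr>)"
    using hom_mult [OF d] by (intro homI) auto
  moreover have "(\<lambda>x. d ` (W \<inter> F) #>\<^bsub>L\<^esub> x) \<in> hom (L\<lparr>carrier := d ` W\<rparr>) ?C"
    by (intro L.coset_hom subgroups) auto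
  ultimately have "?q \<in> hom ?A ?C"
    using hom_compose unfolding comp_def by blast
  moreover have C: "comm_group ?C"
    by (intro L.comm_group_subquot subgroups) auto
  ultimately have q: "group_hom ?A ?C ?q"
    using A by (auto simp: group_hom_def group_hom_axioms_def comm_group_def)
  have p_onto: "?p ` carrier ?A = carrier (HW Mod ?I)"
    by (auto simp: carrier_FactGroup)
  have q_onto: "?q ` carrier ?A = carrier ?C"
    by (auto simp: carrier_FactGroup)
  have "kernel ?A (HW Mod ?I) ?p = {x \<in> W. ?p x = ?I}"
    by (simp add: kernel_def [of ?A])
  also have "\<dots> = {x \<in> W. \<tau> ` B #>\<^bsub>N\<^esub> \<tau> x \<in> ?I}"
    by (intro Collect_cong conj_cong refl HW.coset_eq_self_iff I) (auto simp: carrier_subquot)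
  also have "\<dots> = {x \<in> W. \<exists>z\<in>Z. \<tau> x = \<tau> z}"
  proof (intro Collect_cong conj_cong refl)
    fix x assume x: "x \<in> W"
    have "\<tau> ` B #>\<^bsub>N\<^esub> \<tau> x \<in> ?I \<longleftrightarrow> (\<exists>z\<in>Z. \<exists>b\<in>B. \<tau> x = \<tau> b \<otimes>\<^bsub>N\<^esub> \<tau> z)"
      using x by (auto simp: I_eq image_iff N.coset_eq_iff subgroups)
    \<comment> \<open>Coboundaries are cocycles, so \<open>b\<close> is absorbed into
      \<open>z\<close>.\<close>
    also have "\<dots> \<longleftrightarrow> (\<exists>z\<in>Z. \<tau> x = \<tau> z)"
    proof
      assume "\<exists>z\<in>Z. \<exists>b\<in>B. \<tau> x = \<tau> b \<otimes>\<^bsub>N\<^esub> \<tau> z"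
      then obtain z b where "z \<in> Z" "b \<in> B" "\<tau> x = \<tau> (b \<otimes>\<^bsub>M\<^esub> z)"
        by (auto simp: hom_mult [OF \<tau>])
      moreover have "b \<otimes>\<^bsub>M\<^esub> z \<in> Z"
        using calculation B_Z by (intro subgroup.m_closed subgroups) auto
      ultimately show "\<exists>z\<in>Z. \<tau> x = \<tau> z"
        by blast
    next
      assume "\<exists>z\<in>Z. \<tau> x = \<tau> z"
      then show "\<exists>z\<in>Z. \<exists>b\<in>B. \<tau> x = \<tau> b \<otimes>\<^bsub>N\<^esub> \<tau> z"
        using hom_one [OF \<tau> M.is_group N.is_group] x subgroup.one_closed [OF B]
        by (metis N.l_one closed(1) mem_carrier(3))
    qed
    finally show "\<tau> ` B #>\<^bsub>N\<^esub> \<tau> x \<in> ?I \<longleftrightarrow> (\<exists>z\<in>Z. \<tau> x = \<tau> z)" .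
  qed
  \<comment> \<open>Both conditions say that \<open>x\<close> is the product of an element of
    \<open>Z\<close> and one of \<open>W \<inter> F\<close>: given \<open>z\<close>, take
    \<open>f = inv z \<otimes> x\<close>; given \<open>f\<close>, take
    \<open>z = inv f \<otimes> x\<close>.\<close>
  also have "\<dots> = {x \<in> W. \<exists>f\<in>W \<inter> F. d x = d f}"
  proof (intro Collect_cong conj_cong refl iffI)
    fix x assume x: "x \<in> W"
    {
      assume "\<exists>z\<in>Z. \<tau> x = \<tau> z"
      then obtain z where z: "z \<in> Z" "\<tau> x = \<tau> z" by blast
      then have "inv\<^bsub>M\<^esub> z \<otimes>\<^bsub>M\<^esub> x \<in> F" "inv\<^bsub>M\<^esub> z \<otimes>\<^bsub>M\<^esub> x \<in> W"
        using x Z_W by (auto intro!: mult_inv_kernel subgroup.m_closed [OF W] subgroup.m_inv_closed [OF W])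
      moreover have "d (inv\<^bsub>M\<^esub> z \<otimes>\<^bsub>M\<^esub> x) = d x"
      proof -
        interpret d: group_hom M L d by (rule group_hom_d)
        show ?thesis
          using x z by auto
      qed
      ultimately show "\<exists>f\<in>W \<inter> F. d x = d f"
        by (metis IntI)
    next
      assume "\<exists>f\<in>W \<inter> F. d x = d f"
      then obtain f where f: "f \<in> W" "f \<in> F" "d x = d f" by blast
      then have "inv\<^bsub>M\<^esub> f \<otimes>\<^bsub>M\<^esub> x \<in> Z"
        using x by (auto intro!: mult_inv_kernel)
      moreover have "\<tau> (inv\<^bsub>M\<^esub> f \<otimes>\<^bsub>M\<^esub> x) = \<tau> x"
      proof -
        interpret \<tau>: group_hom M N \<tau> by (rule group_hom_\<tau>)
        show ?thesis
          using x f by auto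
      qed
      ultimately show "\<exists>z\<in>Z. \<tau> x = \<tau> z"
        by metis
    }
  qed
  finally have ker_p: "kernel ?A (HW Mod ?I) ?p = {x \<in> W. \<exists>f\<in>W \<inter> F. d x = d f}" .
  have q_one: "?q x = d ` (W \<inter> F) \<longleftrightarrow> (\<exists>f\<in>W \<inter> F. d x = d f)" if "x \<in> W" for x
  proof -
    have "?q x = d ` (W \<inter> F) \<longleftrightarrow> d x \<in> d ` (W \<inter> F)"
      by (rule L.coset_eq_self_iff) (use that in \<open>auto intro: subgroups\<close>)
    then show ?thesis
      unfolding image_iff .
  qed
  have "kernel ?A ?C ?q = {x \<in> W. ?q x = d ` (W \<inter> F)}"
    by (simp add: kernel_def [of ?A])
  also have "\<dots> = {x \<in> W. \<exists>f\<in>W \<inter> F. d x = d f}"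
    by (rule Collect_cong, rule conj_cong, rule refl, rule q_one)
  also have "\<dots> = kernel ?A (HW Mod ?I) ?p"
    by (rule ker_p [symmetric])
  finally have ker: "kernel ?A (HW Mod ?I) ?p = kernel ?A ?C ?q"
    by (rule sym)
  have "?A Mod kernel ?A ?C ?q \<cong> HW Mod ?I"
    using group_hom.FactGroup_iso [OF p p_onto] unfolding ker .
  moreover have "group (?A Mod kernel ?A ?C ?q)"
    by (intro normal.factorgroup_is_group group_hom.normal_kernel q)
  ultimately have "HW Mod ?I \<cong> ?A Mod kernel ?A ?C ?q"
    by (metis group.iso_sym)
  also have "?A Mod kernel ?A ?C ?q \<cong> ?C"
    by (intro group_hom.FactGroup_iso q q_onto)
  finally show ?thesis .
qed

text \<open>If \<open>f\<close> in \<open>F\<close> has the same differential as \<open>x\<close>,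
  then \<open>inv f \<otimes> x\<close> is a cocycle with the same truncation as
  \<open>x\<close>.\<close>

lemma \<phi>_onto:
  assumes "d ` W \<subseteq> d ` (W \<inter> F)"
  shows "\<phi> ` carrier HZ = carrier HW"
proof (intro equalityI subsetI)
  fix X assume "X \<in> carrier HW"
  then obtain x where x: "x \<in> W" "X = \<tau> ` B #>\<^bsub>N\<^esub> \<tau> x"
    by (auto simp: carrier_subquot)
  then obtain f where f: "f \<in> W" "f \<in> F" "d x = d f"
    using assms by blast
  interpret \<tau>: group_hom M N \<tau> by (rule group_hom_\<tau>)
  have "inv\<^bsub>M\<^esub> f \<otimes>\<^bsub>M\<^esub> x \<in> Z"
    using x f by (auto intro!: mult_inv_kernel)
  moreover have "\<tau> (inv\<^bsub>M\<^esub> f \<otimes>\<^bsub>M\<^esub> x) = \<tau> x"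
    using x f by auto
  ultimately show "X \<in> \<phi> ` carrier HZ"
    using x by (auto simp: carrier_subquot image_image \<phi>_coset intro!: rev_image_eqI)
qed (use \<phi>_hom in \<open>auto simp: hom_def\<close>)

declare kernel_eq_one [simp del] mem_carrier [simp del] closed [simp del]

end

section \<open>The total complexes\<close>

lemma tot_iff:
  "x \<in> carrier (tot G K Q n) \<longleftrightarrow>
     (\<forall>q. if q \<in> Q \<and> q \<le> n then x q \<in> carrier (cochains G K (n - q) q) else x q = (\<lambda>gs ks. 1))"
  by (auto simp: tot_def)

lemma mult_tot: "x \<otimes>\<^bsub>tot G K Q n\<^esub> y = (\<lambda>q gs ks. x q gs ks * y q gs ks)"
  by (simp add: tot_def)

lemma one_tot: "\<one>\<^bsub>tot G K Q n\<^esub> = (\<lambda>q gs ks. 1)"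
  by (simp add: tot_def)

lemma tot_nonzero: "x \<in> carrier (tot G K Q n) \<Longrightarrow> x q gs ks \<noteq> 0"
  by (metis tot_iff cochains_nonzero zero_neq_one)

lemma mult_cochains: "x \<otimes>\<^bsub>cochains G K p q\<^esub> y = (\<lambda>gs ks. x gs ks * y gs ks)"
  by (simp add: cochains_def)

lemma one_cochains_eq: "\<one>\<^bsub>cochains G K p q\<^esub> = (\<lambda>gs ks. 1)"
  by (simp add: cochains_def)

lemma cochains_mult:
  assumes "F \<in> carrier (cochains G K p q)" "F' \<in> carrier (cochains G K p q)"
  shows "(\<lambda>gs ks. F gs ks * F' gs ks) \<in> carrier (cochains G K p q)"
  using cochains_mult_powi [OF assms, of 1] by simp

lemma comm_group_cochains: "comm_group (cochains G K p q)"
proof (rule comm_groupI)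
  fix x assume "x \<in> carrier (cochains G K p q)"
  then show "\<exists>y\<in>carrier (cochains G K p q). y \<otimes>\<^bsub>cochains G K p q\<^esub> x = \<one>\<^bsub>cochains G K p q\<^esub>"
    by (intro bexI [OF _ cochains_inverse]) (simp_all add: mult_cochains one_cochains_eq cochains_nonzero)
qed (auto simp: mult_cochains one_cochains_eq cochains_mult one_cochains mult_ac)

lemma comm_group_tot: "comm_group (tot G K Q n)"
proof (rule comm_groupI)
  fix x assume x: "x \<in> carrier (tot G K Q n)"
  then have "(\<lambda>q gs ks. inverse (x q gs ks)) \<in> carrier (tot G K Q n)"
    by (auto simp: tot_iff cochains_inverse split: if_splits)
  then show "\<exists>y\<in>carrier (tot G K Q n). y \<otimes>\<^bsub>tot G K Q n\<^esub> x = \<one>\<^bsub>tot G K Q n\<^esub>"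
    by (rule bexI [rotated]) (simp add: mult_tot one_tot tot_nonzero [OF x])
qed (auto simp: mult_tot one_tot tot_iff cochains_mult one_cochains mult_ac)

text \<open>The projection of Tot(A) onto Tot(A/A^{*,*>r}); for \<open>r = 2\<close> it induces
  \<open>phi\<close>.\<close>

definition tot_truncate :: "nat \<Rightarrow> (nat \<Rightarrow> ('g, 'k) cochain) \<Rightarrow> nat \<Rightarrow> ('g, 'k) cochain" where
  "tot_truncate r x = (\<lambda>q. if q \<le> r then x q else (\<lambda>gs ks. 1))"

text \<open>The inclusion of A^{0,q} into Tot(A).\<close>

definition single :: "nat \<Rightarrow> ('g, 'k) cochain \<Rightarrow> nat \<Rightarrow> ('g, 'k) cochain" where
  "single q F = (\<lambda>j. if j = q then F else (\<lambda>gs ks. 1))"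

text \<open>Component \<open>q\<close> of the differential involves only the components
  \<open>q\<close> and \<open>q - 1\<close>, hence nothing that is truncated when
  \<open>q \<le> r\<close>.\<close>

lemma truncate_tot_d:
  "tot_truncate r (tot_d G K act {1..} n x) = tot_d G K act {1..r} n (tot_truncate r x)"
  by (auto simp: tot_truncate_def tot_d_def fun_eq_iff)

lemma truncate_closed:
  "x \<in> carrier (tot G K {1..} n) \<Longrightarrow> tot_truncate r x \<in> carrier (tot G K {1..r} n)"
  by (auto simp: tot_truncate_def tot_iff)

lemma truncate_hom: "tot_truncate r \<in> hom (tot G K {1..} n) (tot G K {1..r} n)"
  by (rule homI) (use truncate_closed in blast, auto simp: mult_tot tot_truncate_def fun_eq_iff)

lemma single_closed:
  "1 \<le> q \<Longrightarrow> F \<in> carrier (cochains G K 0 q) \<Longrightarrow> single q F \<in> carrier (tot G K {1..} q)"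
  by (auto simp: single_def tot_iff one_cochains)

lemma single_hom: "1 \<le> q \<Longrightarrow> single q \<in> hom (cochains G K 0 q) (tot G K {1..} q)"
  by (rule homI) (use single_closed in blast, auto simp: mult_tot mult_cochains single_def fun_eq_iff)

lemma tot_truncated_eq: "n \<le> r \<Longrightarrow> carrier (tot G K {1..r} n) = carrier (tot G K {1..} n)"
  by (auto simp: tot_iff)

lemma tot_above: "x \<in> carrier (tot G K Q n) \<Longrightarrow> n < q \<Longrightarrow> x q = (\<lambda>gs ks. 1)"
  by (simp add: tot_def)

lemma tot_outside: "x \<in> carrier (tot G K Q n) \<Longrightarrow> q \<notin> Q \<Longrightarrow> x q = (\<lambda>gs ks. 1)"
  by (simp add: tot_def)

lemma one_mem_tot: "(\<lambda>q gs ks. 1) \<in> carrier (tot G K Q n)"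
  by (simp add: tot_def one_cochains)

lemma fil_iff: "x \<in> fil G K s n \<longleftrightarrow> x \<in> carrier (tot G K {1..} n) \<and> (\<forall>q<s. x q = (\<lambda>gs ks. 1))"
proof (intro iffI conjI allI impI)
  assume x: "x \<in> fil G K s n"
  then show "x q = (\<lambda>gs ks. 1)" if "q < s" for q
    using that tot_outside [of x G K "{1..} \<inter> {s..}" n q] by (simp add: fil_def)
  show "x \<in> carrier (tot G K {1..} n)"
    unfolding tot_iff
  proof
    fix q
    show "if q \<in> {1..} \<and> q \<le> n then x q \<in> carrier (cochains G K (n - q) q) else x q = (\<lambda>gs ks. 1)"
      using x [unfolded fil_def tot_iff, rule_format, of q] by (auto simp: one_cochains split: if_splits)
  qed
next
  assume x: "x \<in> carrier (tot G K {1..} n) \<and> (\<forall>q<s. x q = (\<lambda>gs ks. 1))"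
  show "x \<in> fil G K s n"
    unfolding fil_def tot_iff
  proof
    fix q
    show "if q \<in> {1..} \<inter> {s..} \<and> q \<le> n then x q \<in> carrier (cochains G K (n - q) q)
        else x q = (\<lambda>gs ks. 1)"
      using conjunct1 [OF x, unfolded tot_iff, rule_format, of q] x by (auto split: if_splits)
  qed
qed

lemma fil_eq_tot: "s \<le> 1 \<Longrightarrow> fil G K s n = carrier (tot G K {1..} n)"
  using tot_outside [of _ G K "{1..}" n] by (auto simp: fil_iff)

lemma fil_mono: "s \<le> t \<Longrightarrow> fil G K t n \<subseteq> fil G K s n"
  by (auto simp: fil_iff)

lemma one_mem_fil: "(\<lambda>q gs ks. 1) \<in> fil G K s n"
  by (simp add: fil_iff one_mem_tot)

lemma fil_trivial:
  assumes "n < s"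
  shows "fil G K s n = {\<lambda>q gs ks. 1}"
proof -
  have "x = (\<lambda>q gs ks. 1)" if x: "x \<in> fil G K s n" for x
  proof
    fix q show "x q = (\<lambda>gs ks. 1)"
      using x tot_above [of x G K "{1..}" n q] assms by (cases "q < s") (auto simp: fil_iff)
  qed
  then show ?thesis
    using one_mem_fil by blast
qed

lemma fil_top_single:
  assumes "x \<in> fil G K n n"
  shows "x = single n (x n)"
proof
  fix q show "x q = single n (x n) q"
    using assms tot_above [of x G K "{1..}" n q]
    by (cases "q < n"; cases "q = n") (auto simp: fil_iff single_def)
qed

lemma kernel_truncate:
  "kernel (tot G K {1..} n) (tot G K {1..r} n) (tot_truncate r) = fil G K (Suc r) n"
  unfolding kernel_def set_eq_iff fil_iff one_tot tot_truncate_def fun_eq_iff less_Suc_eq_le by auto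

section \<open>The total differential\<close>

context equivariant_monoid
begin

text \<open>The edges need care: for \<open>q = n + 1\<close> the index \<open>n - q\<close> is
  truncated, but then \<open>x q\<close> is trivial; likewise \<open>x (q - 1)\<close> is trivial if
  \<open>q - 1\<close> is outside \<open>Q\<close>.\<close>

lemma tot_component:
  assumes x: "x \<in> carrier (tot G K Q n)" and q: "0 \<notin> Q" "q \<le> Suc n"
  shows "delta_G G K act (n - q) q (x q) \<in> carrier (cochains G K (Suc n - q) q)"
    and "q \<in> Q \<Longrightarrow> delta_K G K (Suc n - q) (q - 1) (x (q - 1)) \<in> carrier (cochains G K (Suc n - q) q)"
proof -
  show "delta_G G K act (n - q) q (x q) \<in> carrier (cochains G K (Suc n - q) q)"
  proof (cases "q \<in> Q \<and> q \<le> n")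
    case True
    then have "x q \<in> carrier (cochains G K (n - q) q)"
      using x by (auto simp: tot_iff)
    from delta_G_closed [OF this] show ?thesis
      using True by (simp add: Suc_diff_le)
  next
    case False
    then have "x q = (\<lambda>gs ks. 1)"
      using x by (meson tot_iff)
    then show ?thesis
      by (simp add: one_cochains)
  qed
  assume "q \<in> Q"
  then obtain l where l: "q = Suc l"
    using q by (cases q) auto
  show "delta_K G K (Suc n - q) (q - 1) (x (q - 1)) \<in> carrier (cochains G K (Suc n - q) q)"
  proof (cases "l \<in> Q")
    case True
    then have "x l \<in> carrier (cochains G K (n - l) l)"
      using x q l by (auto simp: tot_iff)
    from delta_K_closed [OF this] show ?thesis
      by (simp add: l)
  next
    case False
    then have "x l = (\<lambda>gs ks. 1)"
      using x by (meson tot_iff)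
    then show ?thesis
      by (simp add: one_cochains l)
  qed
qed

lemma tot_d_closed:
  assumes x: "x \<in> carrier (tot G K Q n)" and Q: "0 \<notin> Q"
  shows "tot_d G K act Q n x \<in> carrier (tot G K Q (Suc n))"
  unfolding tot_iff
proof
  fix q
  show "if q \<in> Q \<and> q \<le> Suc n then tot_d G K act Q n x q \<in> carrier (cochains G K (Suc n - q) q)
    else tot_d G K act Q n x q = (\<lambda>gs ks. 1)"
  proof (cases "q \<in> Q \<and> q \<le> Suc n")
    case True
    then show ?thesis
      using cochains_mult_powi [OF tot_component [OF x Q, of q]]
      by (simp add: tot_d_def)
  next
    case False
    then have "tot_d G K act Q n x q = (\<lambda>gs ks. 1)"
    proof (cases "q \<in> Q")
      case True
      with False have "n < q" "n < q - 1"
        by auto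
      with x have "x q = (\<lambda>gs ks. 1)" "x (q - 1) = (\<lambda>gs ks. 1)"
        by (auto intro: tot_above)
      then show ?thesis
        using True by (simp add: tot_d_def)
    qed (simp add: tot_d_def)
    with False show ?thesis
      by (simp only: if_False)
  qed
qed

lemma tot_d_hom: "0 \<notin> Q \<Longrightarrow> tot_d G K act Q n \<in> hom (tot G K Q n) (tot G K Q (Suc n))"
proof (rule homI)
  fix x y
  show "tot_d G K act Q n (x \<otimes>\<^bsub>tot G K Q n\<^esub> y) =
      tot_d G K act Q n x \<otimes>\<^bsub>tot G K Q (Suc n)\<^esub> tot_d G K act Q n y"
    by (simp add: mult_tot tot_d_def fun_eq_iff power_int_mult_distrib mult_ac
      delta_G_mult_powi [where m = 1, simplified] delta_K_mult_powi [where m = 1, simplified])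
qed (rule tot_d_closed)

lemma tot_d_tot_d:
  assumes x: "x \<in> carrier (tot G K Q n)" and Q: "0 \<notin> Q"
  shows "tot_d G K act Q (Suc n) (tot_d G K act Q n x) = (\<lambda>q gs ks. 1)"
proof (intro ext)
  fix q gs ks
  let ?y = "tot_d G K act Q n x"
  have closed: "tot_d G K act Q (Suc n) ?y \<in> carrier (tot G K Q (Suc (Suc n)))"
    by (intro tot_d_closed x Q)
  show "tot_d G K act Q (Suc n) ?y q gs ks = 1"
  proof (cases "q \<in> Q \<and> q \<le> Suc (Suc n)")
    case False
    then show ?thesis
      using closed by (metis tot_iff)
  next
    case True
    then obtain l where q: "q = Suc l" "l \<le> Suc n" "Suc l \<in> Q"
      using Q by (cases q) auto
    have yq: "?y q = (\<lambda>gs ks. delta_G G K act (n - q) q (x q) gs ks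
        * delta_K G K (n - l) l (x l) gs ks powi ((-1) ^ (n - l)))"
      using q by (simp add: tot_d_def)
    \<comment> \<open>The pure G-part and, in \<open>KK\<close>, the pure K-part are trivial by
      themselves.\<close>
    have GG: "delta_G G K act (Suc n - q) q (delta_G G K act (n - q) q (x q)) gs ks = 1"
    proof (cases "q \<le> n")
      case True
      then have "x q \<in> carrier (cochains G K (n - q) q)"
        using x q by (auto simp: tot_iff)
      from delta_G_delta_G [OF this] True show ?thesis
        by (simp add: Suc_diff_le)
    next
      case False
      then have "x q = (\<lambda>gs ks. 1)"
        using x by (meson tot_iff)
      then show ?thesis
        by simp
    qed
    have KK: "delta_K G K (Suc n - l) l (delta_K G K (Suc n - l) (l - 1) (x (l - 1))) gs ks = 1"
      if l: "l \<in> Q"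
    proof -
      from l Q obtain k where k: "l = Suc k"
        by (cases l) auto
      show ?thesis
      proof (cases "k \<in> Q")
        case True
        then have "x k \<in> carrier (cochains G K (n - k) k)"
          using x q k by (auto simp: tot_iff)
        from delta_K_delta_K [OF this] show ?thesis
          by (simp add: k)
      next
        case False
        then have "x k = (\<lambda>gs ks. 1)"
          using x by (meson tot_iff)
        then show ?thesis
          by (simp add: k)
      qed
    qed
    show ?thesis
    proof (cases "l \<in> Q \<and> l \<le> n")
      case True
      define p where "p = n - l"
      have p: "Suc n - l = Suc p" "Suc n - q = p" "n - l = p"
        using True by (auto simp: p_def q)
      have X: "x l \<in> carrier (cochains G K p l)"
        using x True by (auto simp: tot_iff p_def)
      \<comment> \<open>The mixed term. It occurs with exponent \<open>(-1) ^ p\<close> through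
        \<open>?y q\<close> and with exponent \<open>(-1) ^ Suc p\<close> through
        \<open>?y l\<close>, so the two occurrences cancel.\<close>
      let ?a = "delta_G G K act p (Suc l) (delta_K G K p l (x l)) gs ks"
      have "?a \<noteq> 0"
        by (intro cochains_nonzero [OF delta_G_closed [OF delta_K_closed [OF X]]])
      moreover have "delta_G G K act (Suc n - q) q (?y q) gs ks = ?a powi ((-1) ^ p)"
        using GG unfolding yq delta_G_mult_powi by (simp add: p q(1))
      moreover have "delta_K G K (Suc p) l (?y l) gs ks = ?a"
      proof -
        have "?y l = (\<lambda>gs ks. delta_G G K act p l (x l) gs ks
            * delta_K G K (Suc p) (l - 1) (x (l - 1)) gs ks powi ((-1) ^ Suc p))"
          using True by (simp add: tot_d_def p)
        then show ?thesis
          using KK True by (simp only: delta_K_mult_powi delta_G_delta_K p) simp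
      qed
      ultimately show ?thesis
        using q p by (simp add: tot_d_def [of _ _ _ _ "Suc n"] powi_neg_one_power_Suc del: power_Suc)
    next
      case False
      then have xl: "x l = (\<lambda>gs ks. 1)"
        using x by (meson tot_iff)
      then have "delta_G G K act (Suc n - q) q (?y q) gs ks = 1"
        using GG unfolding yq delta_G_mult_powi by simp
      moreover have "delta_K G K (Suc n - l) l (?y l) gs ks = 1"
      proof (cases "l \<in> Q")
        case True
        then have "?y l = (\<lambda>gs ks. 1 * delta_K G K (Suc n - l) (l - 1) (x (l - 1)) gs ks powi ((-1) ^ (Suc n - l)))"
          by (simp add: tot_d_def xl)
        then show ?thesis
          using KK True by (simp only: delta_K_mult_powi delta_K_one) simp
      next
        case False
        then have "?y l = (\<lambda>gs ks. 1)"
          by (simp add: tot_d_def)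
        then show ?thesis
          by simp
      qed
      ultimately show ?thesis
        using q by (simp add: tot_d_def [of _ _ _ _ "Suc n"])
    qed
  qed
qed

abbreviation T where "T \<equiv> tot G K {1..}"
abbreviation D where "D \<equiv> tot_d G K act {1..}"

lemma D_hom: "D n \<in> hom (T n) (T (Suc n))"
  by (intro tot_d_hom) simp

lemma tot_d_one [simp]: "tot_d G K act Q n (\<lambda>q gs ks. 1) = (\<lambda>q gs ks. 1)"
  by (auto simp: tot_d_def fun_eq_iff)

lemma D_D: "x \<in> carrier (T n) \<Longrightarrow> D (Suc n) (D n x) = (\<lambda>q gs ks. 1)"
  by (intro tot_d_tot_d) auto

lemma D_single:
  assumes "1 \<le> q"
  shows "D q (single q F) = (\<lambda>j. if j = q then delta_G G K act 0 q F
    else if j = Suc q then delta_K G K 0 q F else (\<lambda>gs ks. 1))"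
proof
  fix j
  consider "j = 0" | "j = q" | "j = Suc q" | "1 \<le> j" "j \<noteq> q" "j \<noteq> Suc q"
    by linarith
  then show "D q (single q F) j = (if j = q then delta_G G K act 0 q F
    else if j = Suc q then delta_K G K 0 q F else (\<lambda>gs ks. 1))"
    by cases (use assms in \<open>auto simp: tot_d_def single_def fun_eq_iff\<close>)
qed

section \<open>Numerators and denominators of the pages\<close>

lemma one_fil_Z: "(\<lambda>q gs ks. 1) \<in> fil_Z G K act s t n"
  by (simp add: fil_Z_def one_mem_fil)

lemma fil_Z_trivial: "n < s \<Longrightarrow> fil_Z G K act s t n = {\<lambda>q gs ks. 1}"
  by (auto simp: fil_Z_def fil_trivial one_mem_fil)

lemma fil_Z_subset: "fil_Z G K act s t n \<subseteq> carrier (T n)"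
  by (auto simp: fil_Z_def fil_iff)

text \<open>A cochain of degree \<open>n + 1\<close> has no component beyond \<open>n + 1\<close>,
  so the bound \<open>t\<close> forces the differential to be trivial.\<close>

lemma fil_Z_kernel: "Suc n < t \<Longrightarrow> fil_Z G K act s t n = kernel (T n) (T (Suc n)) (D n) \<inter> fil G K s n"
  by (auto simp: fil_Z_def fil_trivial kernel_def one_tot) (auto simp: fil_iff)

lemma fil_Z_inter: "s \<le> s' \<Longrightarrow> fil_Z G K act s' t n = fil_Z G K act s t n \<inter> fil G K s' n"
  using fil_mono by (fastforce simp: fil_Z_def)

lemma fil_Z_mono: "s \<le> s' \<Longrightarrow> fil_Z G K act s' t n \<subseteq> fil_Z G K act s t n"
  using fil_Z_inter by blast

lemma subgroup_fil_Z: "subgroup (fil_Z G K act s t n) (T n)"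
proof -
  interpret T: comm_group "T m" for m by (rule comm_group_tot)
  have sub: "subgroup (fil G K u m) (T m)" for u m
  proof (cases "u = 0")
    case True
    then show ?thesis
      using T.subgroup_self by (simp add: fil_eq_tot)
  next
    case False
    \<comment> \<open>A step of the filtration is the kernel of a truncation, hence a
      subgroup.\<close>
    then obtain r where "u = Suc r"
      by (cases u) auto
    then have "fil G K u m = kernel (T m) (tot G K {1..r} m) (tot_truncate r)"
      by (simp add: kernel_truncate del: One_nat_def)
    moreover have "group_hom (T m) (tot G K {1..r} m) (tot_truncate r)"
      using truncate_hom comm_group.axioms(2) [OF comm_group_tot]
      by (intro group_hom.intro group_hom_axioms.intro)
    ultimately show ?thesis
      by (simp add: group_hom.subgroup_kernel)
  qed
  have "group_hom (T n) (T (Suc n)) (D n)"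
    by (intro group_hom.intro group_hom_axioms.intro T.is_group D_hom)
  then interpret D: group_hom "T n" "T (Suc n)" "D n" .
  have ne: "fil_Z G K act s t n \<noteq> {}"
    using one_fil_Z by blast
  show ?thesis
    by (rule T.subgroupI, rule fil_Z_subset, use ne in blast)
      (use subgroup.m_closed [OF sub] subgroup.m_inv_closed [OF sub] subgroup.mem_carrier [OF sub]
       in \<open>auto simp: fil_Z_def simp del: One_nat_def simp flip: Suc_eq_plus1\<close>)
qed

lemma one_ss_B: "(\<lambda>q gs ks. 1) \<in> ss_B G K act r n q"
proof -
  have "(\<lambda>q gs ks. 1) \<in> D (n - 1) ` fil_Z G K act (q + 1 - r) q (n - 1)"
    using one_fil_Z tot_d_one by (metis image_eqI)
  then show ?thesis
    using one_fil_Z [of "q + 1" "q + r" n] unfolding ss_B_def set_mult_def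
    by (force simp: mult_tot)
qed

text \<open>The case p = 0: the first factor of the denominator has filtration \<open>n + 1\<close>
  in degree \<open>n\<close> and is trivial.\<close>

lemma ss_B_top: "ss_B G K act r n n = D (n - 1) ` fil_Z G K act (n + 1 - r) n (n - 1)"
  by (simp add: ss_B_def fil_Z_trivial set_mult_def mult_tot)

text \<open>Brings the collapse down to representatives: both denominators contain the unit, so
  \<open>D (p + q) x\<close> is itself an element of the set
  \<open>ss_d G K act r p q ?X\<close>.\<close>

lemma collapse:
  assumes "collapses_at_second_page G K act" "2 \<le> r" "x \<in> fil_Z G K act q (q + r) (p + q)"
  shows "D (p + q) x \<in> ss_B G K act r (p + q + 1) (q + r)"
proof -
  let ?X = "ss_B G K act r (p + q) q #>\<^bsub>T (p + q)\<^esub> x"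
  have "?X \<in> carrier (ss_E G K act r p q)"
    using assms(3) by (auto simp: ss_E_def carrier_subquot)
  with assms have "ss_d G K act r p q ?X = ss_B G K act r (p + q + 1) (q + r)"
    by (auto simp: collapses_at_second_page_def)
  moreover have "x \<in> ?X"
    using one_ss_B by (force simp: r_coset_def mult_tot)
  then have "D (p + q) x \<in> ss_d G K act r p q ?X"
    using one_ss_B by (force simp: ss_d_def induced_def set_mult_def mult_tot)
  ultimately show ?thesis
    by simp
qed

section \<open>Identification of the groups\<close>

abbreviation T2 where "T2 \<equiv> tot G K {1..2} 3"
text \<open>The numerator of E_3^{2,1}: in degree 4, filtration 4 leaves only A^{0,4}.\<close>

abbreviation W3 where "W3 \<equiv> fil_Z G K act 1 4 3"
abbreviation Z3 where "Z3 \<equiv> kernel (T 3) (T 4) (D 3)"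
abbreviation B3 where "B3 \<equiv> D 2 ` carrier (T 2)"

lemma D_hom_3: "D 3 \<in> hom (T 3) (T 4)" and D_hom_2: "D 2 \<in> hom (T 2) (T 3)"
  using D_hom [of 3] D_hom [of 2] by (simp_all del: One_nat_def)

lemma truncated: "truncated_complex (T 3) T2 (T 4) (tot_truncate 2) (D 3) W3 B3"
proof -
  have "subgroup B3 (T 3)"
    using comm_group_tot comm_group.axioms(2) D_hom_2
    by (intro subgroup_image [of "T 2"] group.subgroup_self) blast+
  moreover have "B3 \<subseteq> Z3"
    using D_D [of _ 2] hom_in_carrier [OF D_hom_2] by (auto simp: kernel_def one_tot simp del: One_nat_def)
  moreover have "Z3 \<subseteq> W3"
    by (auto simp: kernel_def fil_Z_def fil_eq_tot one_tot one_mem_fil simp del: One_nat_def)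
  ultimately show ?thesis
    by (intro truncated_complex.intro truncated_complex_axioms.intro comm_group_tot truncate_hom
        D_hom_3 subgroup_fil_Z)
qed

lemma tot_H_eq: "tot_H G K act {1..} 3 = subquot (T 3) Z3 B3"
  by (simp add: tot_H_def tot_cocycles_def tot_coboundaries_def del: One_nat_def)

text \<open>Cochains of degree 2 have no components above 2, so they equal their truncations, and
  truncation commutes with the differential.\<close>

lemma truncated_coboundaries: "tot_coboundaries G K act {1..2} 3 = tot_truncate 2 ` B3"
proof -
  have "tot_truncate 2 x = x" if "x \<in> carrier (T 2)" for x
    using tot_above [OF that] by (auto simp: tot_truncate_def fun_eq_iff)
  then have "tot_truncate 2 ` B3 = tot_d G K act {1..2} 2 ` carrier (T 2)"
    by (auto simp: image_image truncate_tot_d simp del: One_nat_def)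
  then show ?thesis
    using tot_truncated_eq [of 2 2 G K] by (simp add: tot_coboundaries_def del: One_nat_def)
qed

lemma phi_eq: "phi G K act = induced T2 (tot_truncate 2 ` B3) (tot_truncate 2)"
  by (simp add: phi_def truncated_coboundaries tot_truncate_def [abs_def] del: One_nat_def)

lemma D_3_3:
  "D 3 w 3 = (\<lambda>gs ks. delta_G G K act 0 3 (w 3) gs ks * inverse (delta_K G K 1 2 (w 2) gs ks))"
  by (simp add: tot_d_def)

text \<open>A lift of \<open>x\<close> to degree 3 adds a component \<open>\<theta>\<close> in
  C^{0,3}. The component of its differential in C^{1,3} is \<open>delta_G\<close> of
  \<open>\<theta>\<close> divided by \<open>delta_K\<close> of \<open>x 2\<close>, which is trivial
  exactly under the condition in \<open>MS\<close>.\<close>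

lemma truncated_W:
  assumes x: "x \<in> carrier T2"
  shows "x \<in> tot_truncate 2 ` W3 \<longleftrightarrow> tot_d G K act {1..2} 3 x = (\<lambda>q gs ks. 1) \<and>
    (\<exists>\<theta>\<in>carrier (cochains G K 0 3). delta_K G K 1 2 (x 2) = delta_G G K act 0 3 \<theta>)"
proof (intro iffI conjI)
  assume "x \<in> tot_truncate 2 ` W3"
  then obtain w where w: "x = tot_truncate 2 w" "w \<in> carrier (T 3)" "D 3 w \<in> fil G K 4 4"
    by (auto simp: fil_Z_def fil_eq_tot simp del: One_nat_def)
  then have "tot_truncate 2 (D 3 w) = (\<lambda>q gs ks. 1)"
    by (auto simp: tot_truncate_def fil_iff fun_eq_iff)
  then show "tot_d G K act {1..2} 3 x = (\<lambda>q gs ks. 1)"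
    using w truncate_tot_d by metis
  have w2: "w 2 \<in> carrier (cochains G K 1 2)" and w3: "w 3 \<in> carrier (cochains G K 0 3)"
    using w(2) unfolding tot_iff by (auto dest: spec [of _ 2] spec [of _ 3])
  have "D 3 w 3 = (\<lambda>gs ks. 1)"
    using w(3) by (simp add: fil_iff)
  then have "delta_G G K act 0 3 (w 3) gs ks * inverse (delta_K G K 1 2 (w 2) gs ks) = 1" for gs ks
    unfolding D_3_3 by metis
  then have "delta_K G K 1 2 (w 2) gs ks = delta_G G K act 0 3 (w 3) gs ks" for gs ks
    using cochains_nonzero [OF delta_K_closed [OF w2]] by (simp add: field_simps)
  then show "\<exists>\<theta>\<in>carrier (cochains G K 0 3). delta_K G K 1 2 (x 2) = delta_G G K act 0 3 \<theta>"
    using w3 by (intro bexI [of _ "w 3"]) (auto simp: w(1) tot_truncate_def)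
next
  assume a: "tot_d G K act {1..2} 3 x = (\<lambda>q gs ks. 1) \<and>
    (\<exists>\<theta>\<in>carrier (cochains G K 0 3). delta_K G K 1 2 (x 2) = delta_G G K act 0 3 \<theta>)"
  then obtain \<theta> where \<theta>: "\<theta> \<in> carrier (cochains G K 0 3)" "delta_K G K 1 2 (x 2) = delta_G G K act 0 3 \<theta>"
    by blast
  define w where "w = x(3 := \<theta>)"
  have w: "w \<in> carrier (T 3)"
    unfolding tot_iff
  proof
    fix q :: nat
    consider "q = 0" | "1 \<le> q" "q \<le> 2" | "q = 3" | "3 < q"
      by linarith
    then show "if q \<in> {1..} \<and> q \<le> 3 then w q \<in> carrier (cochains G K (3 - q) q) else w q = (\<lambda>gs ks. 1)"
      by cases (use x [unfolded tot_iff, rule_format, of q] \<theta> in \<open>auto simp: w_def\<close>)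
  qed
  have tw: "tot_truncate 2 w = x"
    using tot_outside [OF x] by (auto simp: tot_truncate_def w_def fun_eq_iff)
  \<comment> \<open>Component 3 is trivial by the choice of \<open>\<theta>\<close>, the lower ones
    because \<open>x\<close> is a cocycle of the truncated complex.\<close>
  have "D 3 w q = (\<lambda>gs ks. 1)" if "q < 4" for q
  proof (cases "q = 3")
    case True
    have "x 2 \<in> carrier (cochains G K 1 2)"
      using x unfolding tot_iff by (auto dest: spec [of _ 2])
    then have "delta_K G K 1 2 (x 2) gs ks \<noteq> 0" for gs ks
      by (intro cochains_nonzero [OF delta_K_closed])
    with \<theta>(2) True show ?thesis
      unfolding True D_3_3 by (simp add: w_def)
  next
    case False
    with that have "D 3 w q = tot_truncate 2 (D 3 w) q"
      by (simp add: tot_truncate_def)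
    then show ?thesis
      using a by (simp add: truncate_tot_d tw del: One_nat_def)
  qed
  then have "w \<in> W3"
    using w hom_in_carrier [OF D_hom_3 w] by (simp add: fil_Z_def fil_iff del: One_nat_def)
      (simp add: tot_outside [OF w])
  then show "x \<in> tot_truncate 2 ` W3"
    using tw by blast
qed

lemma MS_eq: "MS G K act = subquot T2 (tot_truncate 2 ` W3) (tot_truncate 2 ` B3)"
proof -
  interpret A: truncated_complex "T 3" T2 "T 4" "tot_truncate 2" "D 3" W3 B3
    by (rule truncated)
  let ?B = "tot_truncate 2 ` B3" and ?Z = "tot_cocycles G K act {1..2} 3"
  let ?P = "\<lambda>x. \<exists>\<theta>\<in>carrier (cochains G K 0 3). delta_K G K 1 2 (x 2) = delta_G G K act 0 3 \<theta>"
  have Z: "?Z = {x \<in> carrier T2. tot_d G K act {1..2} 3 x = (\<lambda>q gs ks. 1)}"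
    by (simp add: tot_cocycles_def kernel_def one_tot)
  have TW: "x \<in> tot_truncate 2 ` W3 \<longleftrightarrow> x \<in> ?Z \<and> ?P x" for x
    using truncated_W [of x] subgroup.subset [OF A.subgroups(6)] unfolding Z by blast
  have "group_hom T2 (tot G K {1..2} 4) (tot_d G K act {1..2} 3)"
    using tot_d_hom [of "{1..2}" 3] comm_group_tot [of G K "{1..2}"]
    by (simp add: group_hom_def group_hom_axioms_def comm_group_def)
  then have sZ: "subgroup ?Z T2"
    unfolding tot_cocycles_def by (simp add: group_hom.subgroup_kernel)
  have BZ: "?B \<subseteq> ?Z"
    using TW A.B_Z A.Z_W by blast
  have H: "tot_H G K act {1..2} 3 = subquot T2 ?Z ?B"
    by (simp add: tot_H_def truncated_coboundaries del: One_nat_def)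
  have "{X \<in> carrier (subquot T2 ?Z ?B). \<exists>x\<in>X. ?P x} = (\<lambda>x. ?B #>\<^bsub>T2\<^esub> x) ` tot_truncate 2 ` W3"
  proof (intro equalityI subsetI)
    fix X assume "X \<in> {X \<in> carrier (subquot T2 ?Z ?B). \<exists>x\<in>X. ?P x}"
    then obtain x y where x: "x \<in> ?Z" "X = ?B #>\<^bsub>T2\<^esub> x" "y \<in> X" "?P y"
      by (auto simp: carrier_subquot)
    from x(1) have xc: "x \<in> carrier T2"
      unfolding Z by blast
    \<comment> \<open>\<open>MS\<close> asks for the condition at some element \<open>y\<close> of
      the class, so the class is represented anew by \<open>y\<close>.\<close>
    have X: "X = ?B #>\<^bsub>T2\<^esub> y"
      unfolding x(2) by (rule A.N.repr_independence [OF _ xc A.subgroups(7)]) (use x in simp)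
    have "y \<in> ?Z"
      using x BZ subgroup.m_closed [OF sZ] by (auto simp: r_coset_def)
    with x X TW show "X \<in> (\<lambda>x. ?B #>\<^bsub>T2\<^esub> x) ` tot_truncate 2 ` W3"
      by blast
  next
    fix X assume "X \<in> (\<lambda>x. ?B #>\<^bsub>T2\<^esub> x) ` tot_truncate 2 ` W3"
    then obtain x where x: "x \<in> tot_truncate 2 ` W3" "X = ?B #>\<^bsub>T2\<^esub> x"
      by blast
    then have "x \<in> ?Z" "?P x"
      using TW by blast+
    moreover from \<open>x \<in> ?Z\<close> have "x \<in> carrier T2"
      unfolding Z by blast
    then have "x \<in> X"
      unfolding x(2) by (rule A.N.rcos_self [OF _ A.subgroups(7)])
    ultimately show "X \<in> {X \<in> carrier (subquot T2 ?Z ?B). \<exists>x\<in>X. ?P x}"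
      using x by (auto simp: carrier_subquot)
  qed
  then show ?thesis
    unfolding MS_def H by (simp only: subquot_subset)
qed

lemma fil_3: "fil G K 3 3 = kernel (T 3) T2 (tot_truncate 2)"
  by (simp add: kernel_truncate del: One_nat_def)

lemma ss_E_4_0_3: "ss_E G K act 4 0 3 = subquot (T 3) (Z3 \<inter> fil G K 3 3) (B3 \<inter> fil G K 3 3)"
proof -
  \<comment> \<open>The bound 7 = 3 + 4 exceeds the degree 4 of the differential, which leaves the
    cocycles.\<close>
  have "fil_Z G K act 3 7 3 = Z3 \<inter> fil G K 3 3"
    using fil_Z_kernel [of 3 7 3] by (simp del: One_nat_def)
  \<comment> \<open>For \<open>r = 4\<close> the source has filtration index 3 + 1 - 4 = 0, so every
    cochain of degree 2 with differential in filtration 3 contributes.\<close>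
  moreover have "ss_B G K act 4 3 3 = B3 \<inter> fil G K 3 3"
    using ss_B_top [of 4 3] by (auto simp: fil_Z_def fil_eq_tot simp del: One_nat_def)
  ultimately show ?thesis
    by (simp add: ss_E_def del: One_nat_def)
qed

lemma W3_inter: "fil_Z G K act 3 4 3 = W3 \<inter> fil G K 3 3"
  by (intro fil_Z_inter) simp

text \<open>Both d_3(E_3^{2,1}) and the kernel of the projection from E_2^{0,4} to E_3^{0,4} are
  represented by values of \<open>D 3\<close> on \<open>W3\<close>; hence so is the preimage of the
  former.\<close>

lemma d3_plus_d2_eq: "d3_plus_d2 G K act = subquot (T 4) (D 3 ` W3) (D 3 ` (W3 \<inter> fil G K 3 3))"
proof -
  interpret A: truncated_complex "T 3" T2 "T 4" "tot_truncate 2" "D 3" W3 B3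
    by (rule truncated)
  \<comment> \<open>\<open>?Z\<close> and \<open>?B2\<close> are numerator and denominator of
    E_2^{0,4}; \<open>?B3\<close> is the denominator of E_3^{0,4}.\<close>
  let ?B2 = "D 3 ` (W3 \<inter> fil G K 3 3)" and ?B3 = "D 3 ` fil_Z G K act 2 4 3" and ?Z = "fil_Z G K act 4 6 4"
  have B2: "ss_B G K act 2 4 4 = ?B2"
    using ss_B_top [of 2 4] unfolding W3_inter [symmetric] by simp
  have B3: "ss_B G K act 3 4 4 = ?B3"
    using ss_B_top [of 3 4] by simp
  have sB2: "subgroup ?B2 (T 4)"
    using A.subgroups(9) by (simp add: fil_3)
  have sB3: "subgroup ?B3 (T 4)"
    by (intro subgroup_image [OF _ _ D_hom_3] subgroup_fil_Z A.M.is_group A.L.is_group)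
  have B23: "?B2 \<subseteq> ?B3" and B3W: "?B3 \<subseteq> D 3 ` W3"
    unfolding W3_inter [symmetric] by (intro image_mono fil_Z_mono; simp)+
  have WZ: "D 3 ` W3 \<subseteq> ?Z"
  proof
    fix z assume "z \<in> D 3 ` W3"
    then obtain w where "w \<in> carrier (T 3)" "z = D 3 w" "z \<in> fil G K 4 4"
      by (auto simp: fil_Z_def fil_eq_tot simp del: One_nat_def)
    then show "z \<in> ?Z"
      using D_D [of w 3] by (simp add: fil_Z_def one_mem_fil del: One_nat_def)
  qed
  have E: "ss_E G K act 2 0 4 = subquot (T 4) ?Z ?B2"
    by (simp add: ss_E_def B2 del: One_nat_def)
  have pr: "E2_to_E3 G K act (?B2 #>\<^bsub>T 4\<^esub> z) = ?B3 #>\<^bsub>T 4\<^esub> z" if "z \<in> carrier (T 4)" for z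
  proof -
    have "(\<lambda>x. x) \<in> hom (T 4) (T 4)" "(\<lambda>x. x) ` ?B2 \<subseteq> ?B3"
      using B23 by (auto simp: hom_def)
    from induced_coset [OF A.L.comm_group_axioms this(1) subgroup.subset [OF sB2]
      subgroup.one_closed [OF sB2] sB3 this(2) that A.L.is_group]
    show ?thesis
      unfolding E2_to_E3_def B3 .
  qed
  \<comment> \<open>The denominator of E_3^{2,1}. \<open>D 3\<close> kills its coboundary part and
    maps the rest into \<open>?B3\<close>, so d_3 can be computed on representatives.\<close>
  define C where "C = ss_B G K act 3 3 1"
  have C: "C \<subseteq> carrier (T 3)" "\<one>\<^bsub>T 3\<^esub> \<in> C" "D 3 ` C \<subseteq> ?B3"
  proof -
    have c: "x \<in> carrier (T 3) \<and> D 3 x \<in> ?B3" if "x \<in> C" for x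
    proof -
      have "C = fil_Z G K act 2 4 3 <#>\<^bsub>T 3\<^esub> D 2 ` fil_Z G K act 0 1 2"
        by (simp add: C_def ss_B_def del: One_nat_def)
      with that obtain f y where f: "f \<in> fil_Z G K act 2 4 3" "y \<in> fil_Z G K act 0 1 2"
        and x: "x = f \<otimes>\<^bsub>T 3\<^esub> D 2 y"
        unfolding set_mult_def by blast
      have y: "y \<in> carrier (T 2)"
        using f(2) fil_Z_subset by blast
      have fy: "f \<in> carrier (T 3)" "D 2 y \<in> carrier (T 3)"
        using f fil_Z_subset hom_in_carrier [OF D_hom_2 y] by blast+
      have "D 3 x = D 3 f \<otimes>\<^bsub>T 4\<^esub> D 3 (D 2 y)"
        unfolding x by (rule hom_mult [OF D_hom_3 fy])
      also have "D 3 (D 2 y) = (\<lambda>q gs ks. 1)"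
        using D_D [OF y] by simp
      finally have "D 3 x = D 3 f"
        by (simp add: mult_tot)
      moreover have "x \<in> carrier (T 3)"
        unfolding x by (rule A.M.m_closed [OF fy])
      ultimately show ?thesis
        using f(1) by blast
    qed
    then show "C \<subseteq> carrier (T 3)" "D 3 ` C \<subseteq> ?B3"
      by blast+
    show "\<one>\<^bsub>T 3\<^esub> \<in> C"
      unfolding one_tot C_def by (rule one_ss_B)
  qed
  have d3: "ss_d G K act 3 2 1 (C #>\<^bsub>T 3\<^esub> x) = ?B3 #>\<^bsub>T 4\<^esub> D 3 x" if "x \<in> carrier (T 3)" for x
    using induced_coset [OF A.L.comm_group_axioms D_hom_3 C(1,2) sB3 C(3) that A.M.is_group]
    by (simp add: ss_d_def B3 del: One_nat_def)
  have "carrier (ss_E G K act 3 2 1) = (\<lambda>x. C #>\<^bsub>T 3\<^esub> x) ` W3"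
    by (simp add: ss_E_def carrier_subquot C_def del: One_nat_def)
  then have im: "ss_d G K act 3 2 1 ` carrier (ss_E G K act 3 2 1) = (\<lambda>x. ?B3 #>\<^bsub>T 4\<^esub> D 3 x) ` W3"
    by (simp only: image_image) (intro image_cong refl d3 A.mem_carrier)
  have "{X \<in> carrier (subquot (T 4) ?Z ?B2). E2_to_E3 G K act X \<in> (\<lambda>x. ?B3 #>\<^bsub>T 4\<^esub> D 3 x) ` W3} =
      (\<lambda>x. ?B2 #>\<^bsub>T 4\<^esub> x) ` D 3 ` W3"
  proof (intro equalityI subsetI)
    fix X assume "X \<in> {X \<in> carrier (subquot (T 4) ?Z ?B2).
      E2_to_E3 G K act X \<in> (\<lambda>x. ?B3 #>\<^bsub>T 4\<^esub> D 3 x) ` W3}"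
    then obtain z w where z: "z \<in> ?Z" "X = ?B2 #>\<^bsub>T 4\<^esub> z" "w \<in> W3"
      "E2_to_E3 G K act X = ?B3 #>\<^bsub>T 4\<^esub> D 3 w"
      by (auto simp: carrier_subquot simp del: One_nat_def)
    then have zc: "z \<in> carrier (T 4)" and wc: "D 3 w \<in> carrier (T 4)"
      using fil_Z_subset A.mem_carrier(3) A.closed(2) by blast+
    have "?B3 #>\<^bsub>T 4\<^esub> z = ?B3 #>\<^bsub>T 4\<^esub> D 3 w"
      using z(4) pr [OF zc] unfolding z(2) by (rule trans [OF sym, rotated])
    then obtain b where "b \<in> ?B3" "z = b \<otimes>\<^bsub>T 4\<^esub> D 3 w"
      unfolding A.L.coset_eq_iff [OF sB3 zc wc] by blast
    then have "z \<in> D 3 ` W3"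
      using B3W z(3) subgroup.m_closed [OF A.subgroups(8)] by blast
    then show "X \<in> (\<lambda>x. ?B2 #>\<^bsub>T 4\<^esub> x) ` D 3 ` W3"
      using z by blast
  next
    fix X assume "X \<in> (\<lambda>x. ?B2 #>\<^bsub>T 4\<^esub> x) ` D 3 ` W3"
    then obtain w where w: "w \<in> W3" "X = ?B2 #>\<^bsub>T 4\<^esub> D 3 w"
      by blast
    then have "E2_to_E3 G K act X = ?B3 #>\<^bsub>T 4\<^esub> D 3 w"
      using pr A.mem_carrier(3) A.closed(2) by blast
    with w WZ show "X \<in> {X \<in> carrier (subquot (T 4) ?Z ?B2).
      E2_to_E3 G K act X \<in> (\<lambda>x. ?B3 #>\<^bsub>T 4\<^esub> D 3 x) ` W3}"
      by (auto simp: carrier_subquot simp del: One_nat_def)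
  qed
  then show ?thesis
    unfolding d3_plus_d2_def im E by (simp only: subquot_subset)
qed

section \<open>Invariant cochains\<close>

abbreviation C where "C \<equiv> cochains G K 0"
abbreviation I where "I q \<equiv> carrier (inv_cochains G K act q)"

text \<open>At a single group element, \<open>delta_G\<close> of \<open>F\<close> is the quotient of
  \<open>F\<close> by its translate, so invariance is the cocycle condition for p = 0.\<close>

lemma I_iff: "F \<in> I q \<longleftrightarrow> F \<in> carrier (C q) \<and> delta_G G K act 0 q F = (\<lambda>gs ks. 1)"
proof -
  have "delta_G G K act 0 q F = (\<lambda>gs ks. 1) \<longleftrightarrow>
      (\<forall>g\<in>carrier G. \<forall>ks\<in>tuples K q. F [] (map (act g) ks) = F [] ks)"
    if F: "F \<in> carrier (C q)"
  proof -
    have eq: "delta_G G K act 0 q F [g] ks = F [] ks * inverse (F [] (map (act g) ks))"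
      if "g \<in> carrier G" "ks \<in> tuples K q" for g ks
      using that by (simp add: delta_G_def tuples_def)
    have "delta_G G K act 0 q F = (\<lambda>gs ks. 1) \<longleftrightarrow>
        (\<forall>gs\<in>tuples G 1. \<forall>ks\<in>tuples K q. delta_G G K act 0 q F gs ks = 1)"
      unfolding fun_eq_iff using delta_G_outside [of _ G 0 _ K q act F] by auto
    also have "\<dots> \<longleftrightarrow> (\<forall>g\<in>carrier G. \<forall>ks\<in>tuples K q. delta_G G K act 0 q F [g] ks = 1)"
      by (auto simp: tuples_def length_Suc_conv)
    also have "\<dots> \<longleftrightarrow> (\<forall>g\<in>carrier G. \<forall>ks\<in>tuples K q. F [] (map (act g) ks) = F [] ks)"
      by (intro ball_cong refl) (auto simp: eq cochains_nonzero [OF F] field_simps)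
    finally show ?thesis .
  qed
  then show ?thesis
    by (auto simp: inv_cochains_def)
qed

text \<open>The set is the numerator of E_1^{0,q}. The differential of \<open>single q F\<close> has
  the components \<open>delta_G\<close> of \<open>F\<close> at \<open>q\<close> and
  \<open>delta_K\<close> of \<open>F\<close> at \<open>q + 1\<close>; filtration
  \<open>q + 1\<close> demands that the first be trivial.\<close>

lemma single_fil_Z_iff:
  assumes "1 \<le> q" "F \<in> carrier (C q)"
  shows "single q F \<in> fil_Z G K act q (Suc q) q \<longleftrightarrow> F \<in> I q"
proof -
  have "single q F \<in> fil G K q q"
    using single_closed [OF assms] by (auto simp: fil_iff single_def)
  moreover have "D q (single q F) \<in> carrier (T (Suc q))"
    by (intro hom_in_carrier [OF D_hom] single_closed assms)
  ultimately show ?thesis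
    using assms by (auto simp: fil_Z_def fil_iff D_single I_iff less_Suc_eq simp del: One_nat_def simp flip: Suc_eq_plus1)
qed

lemma D_single_invariant:
  "1 \<le> q \<Longrightarrow> F \<in> I q \<Longrightarrow> D q (single q F) = single (Suc q) (delta_K G K 0 q F)"
  by (subst D_single) (auto simp: I_iff single_def fun_eq_iff)

lemma single_inject: "single q F = single q F' \<Longrightarrow> F = F'"
  by (metis single_def)

lemma fil_Z_top:
  assumes "1 \<le> q"
  shows "fil_Z G K act q (Suc q) q = single q ` I q"
proof (intro equalityI subsetI)
  fix x assume x: "x \<in> fil_Z G K act q (Suc q) q"
  then have "x \<in> fil G K q q"
    by (simp add: fil_Z_def)
  then have s: "x = single q (x q)" and "x \<in> carrier (T q)"
    by (auto simp: fil_iff intro: fil_top_single)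
  then have "x q \<in> carrier (C q)"
    using assms unfolding tot_iff by (auto dest: spec [of _ q])
  then show "x \<in> single q ` I q"
    using x s single_fil_Z_iff [OF assms] by (metis imageI)
qed (use assms single_fil_Z_iff in \<open>auto simp: I_iff\<close>)

lemma delta_K_hom: "delta_K G K p q \<in> hom (cochains G K p q) (cochains G K p (Suc q))"
  by (rule homI) (auto simp: delta_K_closed mult_cochains fun_eq_iff delta_K_mult_powi [where m = 1, simplified])

lemma delta_G_hom: "delta_G G K act p q \<in> hom (cochains G K p q) (cochains G K (Suc p) q)"
  by (rule homI) (auto simp: delta_G_closed mult_cochains fun_eq_iff delta_G_mult_powi [where m = 1, simplified])

lemma subgroup_I: "subgroup (I q) (C q)"
proof -
  have "I q = kernel (C q) (cochains G K 1 q) (delta_G G K act 0 q)"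
    by (auto simp: I_iff kernel_def one_cochains_eq)
  moreover have "group_hom (C q) (cochains G K 1 q) (delta_G G K act 0 q)"
    using delta_G_hom [of 0 q] comm_group_cochains
    by (auto simp: group_hom_def group_hom_axioms_def comm_group_def)
  ultimately show ?thesis
    by (simp add: group_hom.subgroup_kernel)
qed

lemma delta_K_invariant:
  assumes "F \<in> I q"
  shows "delta_K G K 0 q F \<in> I (Suc q)"
proof -
  have "delta_G G K act 0 (Suc q) (delta_K G K 0 q F) = delta_K G K (Suc 0) q (delta_G G K act 0 q F)"
    by (intro ext delta_G_delta_K)
  with assms show ?thesis
    by (auto simp: I_iff delta_K_closed)
qed

abbreviation ZI where "ZI \<equiv> {F \<in> I 3. delta_K G K 0 3 F = (\<lambda>gs ks. 1)}"
abbreviation BI where "BI \<equiv> delta_K G K 0 2 ` I 2"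

lemma inv_H_eq: "inv_H G K act 3 = subquot (C 3) ZI BI"
  by (simp add: inv_H_def kernel_def inv_cochains_def one_cochains_eq del: One_nat_def)

lemma invariant_subgroups: "subgroup ZI (C 3)" "subgroup BI (C 3)" "BI \<subseteq> ZI"
proof -
  have g: "group (cochains G K p q)" for p q
    using comm_group_cochains comm_group.axioms(2) by blast
  have h: "delta_K G K 0 2 \<in> hom (C 2) (C 3)" "delta_K G K 0 3 \<in> hom (C 3) (C 4)"
    using delta_K_hom [of 0 2] delta_K_hom [of 0 3] by (simp_all del: One_nat_def)
  have "ZI = I 3 \<inter> kernel (C 3) (C 4) (delta_K G K 0 3)"
    by (auto simp: kernel_def I_iff one_cochains_eq)
  moreover have "subgroup (kernel (C 3) (C 4) (delta_K G K 0 3)) (C 3)"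
    using h g by (intro group_hom.subgroup_kernel) (simp add: group_hom_def group_hom_axioms_def)
  ultimately show "subgroup ZI (C 3)"
    using group.subgroups_Inter_pair [OF g subgroup_I] by simp
  show "subgroup BI (C 3)"
    by (intro subgroup_image [OF _ _ h(1)] subgroup_I g)
  show "BI \<subseteq> ZI"
  proof
    fix x assume "x \<in> BI"
    then obtain F where F: "F \<in> I 2" "x = delta_K G K 0 2 F"
      by blast
    then have "delta_K G K 0 3 (delta_K G K 0 2 F) gs ks = 1" for gs ks
      using delta_K_delta_K [of F 0 2] by (simp add: I_iff)
    then show "x \<in> ZI"
      unfolding F(2) using delta_K_invariant [OF F(1)] by (simp add: fun_eq_iff)
  qed
qed

text \<open>For a cochain concentrated in A^{0,3}, the two components of the differential express
  invariance and the cocycle condition for \<open>delta_K\<close>.\<close>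

lemma single_ZI: "single 3 ` ZI = Z3 \<inter> fil G K 3 3"
proof -
  have "Z3 \<inter> fil G K 3 3 = {x \<in> fil_Z G K act 3 4 3. D 3 x = (\<lambda>q gs ks. 1)}"
    by (auto simp: kernel_def fil_Z_def one_tot one_mem_fil one_mem_tot fil_iff simp del: One_nat_def)
  also have "\<dots> = {x \<in> single 3 ` I 3. D 3 x = (\<lambda>q gs ks. 1)}"
    using fil_Z_top [of 3] by simp
  also have "\<dots> = single 3 ` ZI"
  proof -
    have "D 3 (single 3 F) = (\<lambda>q gs ks. 1) \<longleftrightarrow> delta_K G K 0 3 F = (\<lambda>gs ks. 1)" if "F \<in> I 3" for F
    proof -
      have "D 3 (single 3 F) = single 4 (delta_K G K 0 3 F)"
        using D_single_invariant [OF _ that] by simp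
      moreover have "(\<lambda>q gs ks. 1) = single 4 (\<lambda>gs ks. 1)"
        by (auto simp: single_def)
      ultimately show ?thesis
        using single_inject by metis
    qed
    then show ?thesis
      by blast
  qed
  finally show ?thesis ..
qed

text \<open>The right side is the denominator of E_2^{0,3}, so this links the second page to the
  coboundaries of invariant cochains.\<close>

lemma single_BI: "single 3 ` BI = D 2 ` fil_Z G K act 2 3 2"
proof -
  have "single 3 (delta_K G K 0 2 F) = D 2 (single 2 F)" if "F \<in> I 2" for F
    using D_single_invariant [OF _ that] by simp
  then have "single 3 ` BI = D 2 ` single 2 ` I 2"
    by (force simp: image_image simp del: One_nat_def)
  then show ?thesis
    using fil_Z_top [of 2] by simp
qed

lemma single_BI_subset: "single 3 ` BI \<subseteq> B3 \<inter> fil G K 3 3"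
  unfolding single_BI by (auto simp: fil_Z_def fil_iff simp del: One_nat_def)

section \<open>The collapsing case\<close>

lemma short_exact_collapse:
  assumes "collapses_at_second_page G K act"
  shows "short_exact (inv_H G K act 3) (tot_H G K act {1..} 3) (MS G K act)
    (inv_H_to_tot_H G K act 3) (phi G K act)"
proof -
  interpret A: truncated_complex "T 3" T2 "T 4" "tot_truncate 2" "D 3" W3 B3
    by (rule truncated)
  let ?f = "induced (T 3) B3 (single 3)"
  have f: "inv_H_to_tot_H G K act 3 = ?f"
    by (simp add: inv_H_to_tot_H_def tot_coboundaries_def single_def [abs_def] del: One_nat_def)
  have single_hom_3: "single 3 \<in> hom (C 3) (T 3)"
    by (rule single_hom) simp
  \<comment> \<open>Injectivity: if \<open>single 3 F = D 2 y\<close>, then \<open>y\<close>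
    represents an element of E_2^{1,1}, and triviality of d_2 there allows \<open>y\<close> to be
    replaced by an invariant cochain.\<close>
  have BI_iff: "F \<in> BI" if "F \<in> ZI" "single 3 F \<in> B3" for F
  proof -
    from that(2) obtain y where y: "y \<in> carrier (T 2)" "single 3 F = D 2 y"
      by blast
    moreover have "single 3 F \<in> fil G K 3 3"
      using that(1) single_ZI by blast
    ultimately have "y \<in> fil_Z G K act 1 3 2"
      by (simp add: fil_Z_def fil_eq_tot del: One_nat_def)
    then have "D 2 y \<in> ss_B G K act 2 3 3"
      using collapse [OF assms, of 2 y 1 1] by (simp del: One_nat_def)
    then have "single 3 F \<in> single 3 ` BI"
      unfolding single_BI y(2) using ss_B_top [of 2 3] by simp
    then show ?thesis
      using single_inject by fast
  qed
  \<comment> \<open>A cochain is moved up the filtration without changing its differential: from 1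
    to 2 by triviality of d_3 on E_3^{2,1}, from 2 to 3 by that of d_2 on E_2^{1,2}.\<close>
  have onto: "D 3 ` W3 \<subseteq> D 3 ` (W3 \<inter> fil G K 3 3)"
  proof -
    have "D 3 x \<in> D 3 ` fil_Z G K act 2 4 3" if "x \<in> W3" for x
      using collapse [OF assms, of 3 x 1 2] ss_B_top [of 3 4] that by (simp del: One_nat_def)
    moreover have "D 3 x \<in> D 3 ` fil_Z G K act 3 4 3" if "x \<in> fil_Z G K act 2 4 3" for x
      using collapse [OF assms, of 2 x 2 1] ss_B_top [of 2 4] that by (simp del: One_nat_def)
    ultimately show ?thesis
      unfolding W3_inter [symmetric] by fastforce
  qed
  have c: "comm_group (inv_H G K act 3)"
    unfolding inv_H_eq by (intro comm_group.comm_group_subquot comm_group_cochains invariant_subgroups)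
  have fhom: "?f \<in> hom (subquot (C 3) ZI BI) (subquot (T 3) Z3 B3)"
    using single_ZI single_BI_subset
    by (intro induced_hom comm_group_cochains comm_group_tot single_hom_3 invariant_subgroups
      A.subgroups A.B A.B_Z) auto
  have f_coset: "?f (BI #>\<^bsub>C 3\<^esub> F) = B3 #>\<^bsub>T 3\<^esub> single 3 F" if "F \<in> ZI" for F
    using that single_BI_subset comm_group.axioms(2) [OF comm_group_cochains]
    by (intro induced_coset comm_group_tot single_hom_3 A.B)
      (auto simp: I_iff subgroup.one_closed [OF invariant_subgroups(2)]
        intro: subgroup.mem_carrier [OF invariant_subgroups(2)])
  have gh: "group_hom (subquot (C 3) ZI BI) (subquot (T 3) Z3 B3) ?f"
    using fhom c A.comm_group_HZ
    by (simp add: group_hom_def group_hom_axioms_def comm_group_def inv_H_eq)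
  have "kernel (subquot (C 3) ZI BI) (subquot (T 3) Z3 B3) ?f \<subseteq> {BI}"
  proof
    fix X assume "X \<in> kernel (subquot (C 3) ZI BI) (subquot (T 3) Z3 B3) ?f"
    then obtain F where F: "F \<in> ZI" "X = BI #>\<^bsub>C 3\<^esub> F" "?f X = B3"
      by (auto simp: kernel_def [of "subquot (C 3) ZI BI"] carrier_subquot)
    have "single 3 F \<in> carrier (T 3)" "F \<in> carrier (C 3)"
      using F(1) subgroup.mem_carrier [OF invariant_subgroups(1)] hom_in_carrier [OF single_hom_3] by blast+
    moreover from this have "single 3 F \<in> B3"
      using F f_coset A.M.coset_eq_self_iff [OF A.B] by simp
    ultimately show "X \<in> {BI}"
      using F BI_iff comm_group.coset_eq_self_iff [OF comm_group_cochains invariant_subgroups(2)] by blast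
  qed
  moreover have "BI \<in> kernel (subquot (C 3) ZI BI) (subquot (T 3) Z3 B3) ?f"
    using subgroup.one_closed [OF group_hom.subgroup_kernel [OF gh]] by (simp only: one_FactGroup)
  ultimately have "kernel (subquot (C 3) ZI BI) (subquot (T 3) Z3 B3) ?f = {\<one>\<^bsub>subquot (C 3) ZI BI\<^esub>}"
    unfolding one_FactGroup by blast
  then have inj: "inj_on ?f (carrier (subquot (C 3) ZI BI))"
    using group_hom.inj_iff_trivial_ker [OF gh] by blast
  \<comment> \<open>Exactness in the middle: by \<open>single_ZI\<close> the image consists of the
    classes of cocycles in A^{0,3}, which form the kernel of \<open>A.\<phi>\<close>.\<close>
  have "?f ` carrier (subquot (C 3) ZI BI) = (\<lambda>F. B3 #>\<^bsub>T 3\<^esub> single 3 F) ` ZI"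
    unfolding carrier_subquot image_image by (intro image_cong refl f_coset)
  also have "\<dots> = (\<lambda>x. B3 #>\<^bsub>T 3\<^esub> x) ` (Z3 \<inter> fil G K 3 3)"
    unfolding single_ZI [symmetric] image_image ..
  also have "\<dots> = kernel (subquot (T 3) Z3 B3) A.HW A.\<phi>"
    using A.kernel_\<phi> by (simp only: fil_3)
  finally have exact: "?f ` carrier (subquot (C 3) ZI BI) = kernel (subquot (T 3) Z3 B3) A.HW A.\<phi>" .
  show ?thesis
    unfolding short_exact_def f tot_H_eq MS_eq phi_eq
    using c A.comm_group_HZ A.comm_group_HW fhom inj exact A.\<phi>_hom A.\<phi>_onto [unfolded fil_3 [symmetric], OF onto]
    by (simp add: mon_def epi_def inv_H_eq comm_group_def)
qed

end

theorem proposition5p9: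
  fixes G :: "('g, 'm) monoid_scheme" and K :: "('k, 'n) monoid_scheme"
    and act :: "'g \<Rightarrow> 'k \<Rightarrow> 'k"
  assumes "equivariant_monoid G K act"
  defines "H3 \<equiv> tot_H G K act {1..} 3"
  shows "group_hom H3 (MS G K act) (phi G K act)
    \<and> H3\<lparr>carrier := kernel H3 (MS G K act) (phi G K act)\<rparr> \<cong> ss_E G K act 4 0 3
    \<and> MS G K act Mod (phi G K act ` carrier H3) \<cong> d3_plus_d2 G K act
    \<and> (collapses_at_second_page G K act \<longrightarrow>
         short_exact (inv_H G K act 3) H3 (MS G K act) (inv_H_to_tot_H G K act 3) (phi G K act))"
proof -
  interpret equivariant_monoid G K act by fact
  interpret A: truncated_complex "T 3" T2 "T 4" "tot_truncate 2" "D 3" W3 B3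
    by (rule truncated)
  show ?thesis
    unfolding H3_def
    using short_exact_collapse A.group_hom_\<phi> A.kernel_\<phi>_iso A.coker_\<phi>_iso
    unfolding tot_H_eq MS_eq phi_eq ss_E_4_0_3 d3_plus_d2_eq fil_3 by blast
qed

end
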